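(* Assume the standing assumptions and suppose $F\in\mathcal S^*$. Let $\sigma\le\infty$ be any stopping time (with respect to an admissible filtration). Then $$\lim_{x\to\infty}\frac{\mathbf P(M_\sigma>x)}{\overline F(x)}=\mathbf E\sigma,$$ where the limit is understood to be $+\infty$ if $\mathbf E\sigma=\infty$.
   Context: Standing assumptions: $\{\xi_n\}_{n\ge1}$ are i.i.d. real random variables with common distribution function $F$ and finite mean $\mathbf E\xi_1=-m<0$. $F$ is long-tailed: $\overline F(x):=1-F(x)>0$ for all $x$, and $\overline F(x-c)/\overline F(x)\to1$ as $x\to\infty$ for every fixed $c>0$. Notation: $S_0=0$ and $S_n=\sum_{i=1}^n\xi_i$; $M_n=\max_{0\le i\le n}S_i$; $M=\sup_{n\ge0}S_n$. Admissible filtration: a stopping time $\sigma$, with values in $\{0,1,2,\dots\}\cup\{\infty\}$, is taken with respect to a filtration $\{\mathcal F_n\}_{n\ge0}$ such that for each $n$ the variable $\xi_n$ is $\mathcal F_n$-measurable and $\xi_{n+1}$ is independent of $\mathcal F_n$. Maximum up to a stopping time: $M_\sigma=\max_{0\le i\le\sigma}S_i$, which means $\sup_{i\ge0}S_i$ on $\{\sigma=\infty\}$. The class $\mathcal S^*$: a distribution function $G$ on $\mathbb R$ belongs to $\mathcal S^*$ iff $\overline G(x)>0$ for all $x$ and $$\int_0^x\overline G(x-y)\overline G(y)\,dy\sim 2m_{G^+}\overline G(x)\quad\text{as }x\to\infty,$$ where $m_{G^+}=\int_0^\infty\overline G(t)\,dt$. *)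

theory Defs
  imports "HOL-Probability.Probability" "HOL-Library.Landau_Symbols"
begin

definition tailF :: "(real \<Rightarrow> real) \<Rightarrow> real \<Rightarrow> real" where
  "tailF G x = 1 - G x"

definition rw :: "(nat \<Rightarrow> 'a \<Rightarrow> real) \<Rightarrow> nat \<Rightarrow> 'a \<Rightarrow> real" where
  "rw \<xi> n \<omega> = (\<Sum>i\<in>{1..n}. \<xi> i \<omega>)"

definition max_upto :: "(nat \<Rightarrow> 'a \<Rightarrow> real) \<Rightarrow> ('a \<Rightarrow> enat) \<Rightarrow> 'a \<Rightarrow> ereal" where
  "max_upto \<xi> \<sigma> \<omega> = (SUP i\<in>{i::nat. enat i \<le> \<sigma> \<omega>}. ereal (rw \<xi> i \<omega>))"

definition mean_plus :: "(real \<Rightarrow> real) \<Rightarrow> real" where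
  "mean_plus G = (LBINT t:{0..}. tailF G t)"

definition S_star :: "(real \<Rightarrow> real) \<Rightarrow> bool" where
  "S_star G \<longleftrightarrow> (\<forall>x. tailF G x > 0) \<and>
     (\<lambda>x. LBINT y:{0..x}. tailF G (x - y) * tailF G y) \<sim>[at_top] (\<lambda>x. 2 * mean_plus G * tailF G x)"

end

(*
  Let H be the tail of F and G x = E(xi - x)^+ its integrated tail.  The condition S* says exactly that
  G (max R (z - y)), seen as a function of the position y of the walk, has expected decrement per step
  at least (m - d) H (z - y) as soon as z - y is large.

  Upper bound (E sigma finite).  The drift of G (max R (z - S_n)) - H z * S_n, accumulated while the walk
  is alive and below z - z0, bounds (m - d) times the expected sum of H (z - S_n) by
  m H z E sigma + o(H z): the linear term compensates the convex function G to first order, so that the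
  test function vanishes at 0 and is nonnegative.  That expected sum is, up to long-tail
  corrections, the probability of passing z by a single jump.  Passing z otherwise requires exceeding
  z - w' and climbing w' more afterwards, which by the maximal inequality for G costs
  a factor G (w' + z0) / G z0, small for large w'.

  Lower bound.  The events "alive at n, |S_i| <= K for i <= n, and the next increment exceeds x + K"
  are disjoint for different n.
*)
theory Submission
  imports Defs
begin

text \<open>Without the truncation at \<open>R\<close>, overshoots far beyond \<open>z\<close> would
  add a term of order \<open>G z\<close> to the drift, and \<open>G z\<close> is much larger than
  \<open>H z\<close>. Freezing \<open>G\<close> at \<open>R\<close> restricts the convolution to
  \<open>[0, z - R]\<close>: of its full value of about \<open>2 * G 0 * H z\<close>, a part of
  about \<open>(G 0 - G R) * H z\<close> near \<open>s = z\<close> drops out. The downward steps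
  have mean size \<open>G 0 + m\<close>, so \<open>(G R - m) * H z\<close> remains, which is how the
  mean of the step emerges.

  The walk can leave the watched region only once, which leaves two errors. One is
  \<open>G z\<close> times the probability of passing \<open>z - R\<close>; that probability is at
  most a constant times the expected sum to be bounded, so \<open>G z\<close> tending to 0 lets the
  error be absorbed. The other is \<open>H z\<close> times the upper tail expectation of an
  integrable \<open>Y\<close>, the sum of the positive increments taken before
  \<open>\<sigma>\<close>. Its mean is \<open>G 0\<close> times the mean of \<open>\<sigma>\<close>,
  and here finiteness of that mean is essential. If it is infinite, the lower bound alone gives the
  limit.\<close>

section \<open>The integrated tail as a convex function\<close>

locale negative_mean_distribution = real_distribution N for N :: "real measure" +
  fixes m :: real
  assumes integrable_id: "integrable N (\<lambda>y. y)"
    and mean_eq: "(\<integral>y. y \<partial>N) = - m"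
    and m_pos: "m > 0"
begin

definition H :: "real \<Rightarrow> real" where "H x = measure N {x<..}"

definition G :: "real \<Rightarrow> real" where "G x = (\<integral>y. max 0 (y - x) \<partial>N)"

lemma H_nonneg: "0 \<le> H x" and H_le_1: "H x \<le> 1"
  by (auto simp: H_def)

lemma H_antimono: "x \<le> y \<Longrightarrow> H y \<le> H x"
  unfolding H_def by (intro finite_measure_mono) auto

lemma H_measurable [measurable]: "H \<in> borel_measurable borel"
proof -
  have "mono (\<lambda>x. - H x)" by (intro monoI) (simp add: H_antimono)
  then have "(\<lambda>x. - H x) \<in> borel_measurable borel" by (rule borel_measurable_mono)
  then have "(\<lambda>x. - (- H x)) \<in> borel_measurable borel" by (rule borel_measurable_uminus)
  then show ?thesis by simp
qed

lemma integrable_pos_part: "integrable N (\<lambda>y. max 0 (y - x))"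
  by (intro integrable_max Bochner_Integration.integrable_diff integrable_id) auto

lemma G_nonneg: "0 \<le> G x"
  unfolding G_def by (intro integral_nonneg_AE) auto

lemma G_antimono: "x \<le> y \<Longrightarrow> G y \<le> G x"
  unfolding G_def by (intro integral_mono integrable_pos_part) auto

lemma G_measurable [measurable]: "G \<in> borel_measurable borel"
proof -
  have "mono (\<lambda>x. - G x)" by (intro monoI) (simp add: G_antimono)
  then have "(\<lambda>x. - G x) \<in> borel_measurable borel" by (rule borel_measurable_mono)
  then have "(\<lambda>x. - (- G x)) \<in> borel_measurable borel" by (rule borel_measurable_uminus)
  then show ?thesis by simp
qed

text \<open>Integrates \<open>(b - a) * indicator {b<..} y \<le> max 0 (y - a) - max 0 (y -
  b)\<close>. Together with \<open>G_diff_le\<close> it stands in for the derivative of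
  \<open>G\<close>, which fails to exist where \<open>H\<close> jumps.\<close>

lemma G_diff_ge: "a \<le> b \<Longrightarrow> (b - a) * H b \<le> G a - G b"
proof -
  assume ab: "a \<le> b"
  have "(b - a) * H b = (\<integral>y. (b - a) * indicator {b<..} y \<partial>N)"
    by (simp add: H_def)
  also have "\<dots> \<le> (\<integral>y. max 0 (y - a) - max 0 (y - b) \<partial>N)"
    using ab by (intro integral_mono Bochner_Integration.integrable_diff integrable_pos_part)
      (auto simp: indicator_def intro!: integrable_mult_right integrable_const_bound[where B=1])
  also have "\<dots> = G a - G b"
    unfolding G_def by (rule Bochner_Integration.integral_diff) (rule integrable_pos_part)+
  finally show ?thesis .
qed

lemma G_diff_le: "a \<le> b \<Longrightarrow> G a - G b \<le> (b - a) * H a"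
proof -
  assume ab: "a \<le> b"
  have "G a - G b = (\<integral>y. max 0 (y - a) - max 0 (y - b) \<partial>N)"
    unfolding G_def by (rule Bochner_Integration.integral_diff[symmetric]) (rule integrable_pos_part)+
  also have "\<dots> \<le> (\<integral>y. (b - a) * indicator {a<..} y \<partial>N)"
    using ab by (intro integral_mono Bochner_Integration.integrable_diff integrable_pos_part)
      (auto simp: indicator_def intro!: integrable_mult_right integrable_const_bound[where B=1])
  also have "\<dots> = (b - a) * H a"
    by (simp add: H_def)
  finally show ?thesis .
qed

text \<open>Convexity: \<open>- H z\<close> is a subgradient of \<open>G\<close> at
  \<open>z\<close>, for shifts of either sign. This is what makes the test function of
  \<open>potential_bound\<close> nonnegative up to \<open>z - R\<close>.\<close>

lemma G_above_tangent: "G z + H z * y \<le> G (z - y)"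
proof (cases "y \<ge> 0")
  case True
  then show ?thesis using G_diff_ge[of "z - y" z] by (simp add: algebra_simps)
next
  case False
  then show ?thesis using G_diff_le[of z "z - y"] by (simp add: algebra_simps)
qed

lemma G_tendsto_0: "(G \<longlongrightarrow> 0) at_top"
proof -
  have "((\<lambda>x. \<integral>y. max 0 (y - x) \<partial>N) \<longlongrightarrow> (\<integral>y. 0 \<partial>N)) at_top"
  proof (rule integral_dominated_convergence_at_top[where w="\<lambda>y. max 0 (y - 0)"])
    show "AE y in N. ((\<lambda>x. max 0 (y - x)) \<longlongrightarrow> 0) at_top"
    proof (rule AE_I2)
      fix y :: real
      have "eventually (\<lambda>x. 0 = max 0 (y - x)) at_top"
        using eventually_ge_at_top[of y] by eventually_elim simp
      then show "((\<lambda>x. max 0 (y - x)) \<longlongrightarrow> 0) at_top"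
        by (rule Lim_transform_eventually[OF tendsto_const])
    qed
    show "\<forall>\<^sub>F i in at_top. AE x in N. norm (max 0 (x - i)) \<le> max 0 (x - 0)"
      using eventually_ge_at_top[of 0] by eventually_elim auto
  qed (use integrable_pos_part[of 0] in auto)
  then show ?thesis by (simp add: G_def[abs_def])
qed

section \<open>Layer-cake formulas and the truncated convolution\<close>

text \<open>Tonelli on the set \<open>s < y\<close>. The integrals against \<open>H\<close> below
  are evaluated by choosing \<open>g\<close> and recognising the inner integral, a primitive of
  \<open>g\<close>, as a function of the step \<open>y\<close>.\<close>

lemma tail_fubini:
  assumes [measurable]: "g \<in> borel_measurable borel"
  shows "(\<integral>\<^sup>+y. (\<integral>\<^sup>+s. g s * indicator {..<y} s \<partial>lborel) \<partial>N) = (\<integral>\<^sup>+s. g s * ennreal (H s) \<partial>lborel)"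
proof -
  interpret pair_sigma_finite N lborel
    by (intro pair_sigma_finite.intro sigma_finite_lborel sigma_finite_measure_axioms)
  have "(\<integral>\<^sup>+y. (\<integral>\<^sup>+s. g s * indicator {p. snd p < fst p} (y, s) \<partial>lborel) \<partial>N)
      = (\<integral>\<^sup>+s. (\<integral>\<^sup>+y. g s * indicator {p. snd p < fst p} (y, s) \<partial>N) \<partial>lborel)"
    by (rule Fubini'[symmetric]) (unfold case_prod_beta, measurable)
  also have "\<dots> = (\<integral>\<^sup>+s. g s * ennreal (H s) \<partial>lborel)"
  proof (rule nn_integral_cong)
    fix s
    have "(\<integral>\<^sup>+y. g s * indicator {p. snd p < fst p} (y, s) \<partial>N) = (\<integral>\<^sup>+y. g s * indicator {s<..} y \<partial>N)"
      by (rule nn_integral_cong) (auto simp: indicator_def)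
    also have "\<dots> = g s * ennreal (H s)"
      by (subst nn_integral_cmult_indicator) (auto simp: H_def emeasure_eq_measure)
    finally show "(\<integral>\<^sup>+y. g s * indicator {p. snd p < fst p} (y, s) \<partial>N) = g s * ennreal (H s)" .
  qed
  also have "(\<lambda>y. (\<integral>\<^sup>+s. g s * indicator {p. snd p < fst p} (y, s) \<partial>lborel))
      = (\<lambda>y. (\<integral>\<^sup>+s. g s * indicator {..<y} s \<partial>lborel))"
    by (intro ext nn_integral_cong) (auto simp: indicator_def)
  finally show ?thesis .
qed

lemma G_diff_eq_nn_integral:
  assumes "a \<le> b"
  shows "(\<integral>\<^sup>+s. indicator {a..b} s * ennreal (H s) \<partial>lborel) = ennreal (G a - G b)"
proof -
  have inner: "(\<integral>\<^sup>+s. indicator {a..b} s * indicator {..<y} s \<partial>lborel)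
      = ennreal (max 0 (y - a) - max 0 (y - b))" for y
  proof -
    have "(\<integral>\<^sup>+s. indicator {a..b} s * indicator {..<y} s \<partial>lborel) = emeasure lborel ({a..b} \<inter> {..<y})"
      by (simp add: indicator_inter_arith[symmetric] del: nn_integral_indicator) simp
    also have "{a..b} \<inter> {..<y} = (if y \<le> b then {a..<y} else {a..b})" by auto
    also have "emeasure lborel \<dots> = ennreal (max 0 (y - a) - max 0 (y - b))"
      using assms by (cases "a \<le> y") auto
    finally show ?thesis .
  qed
  have "(\<integral>\<^sup>+s. indicator {a..b} s * ennreal (H s) \<partial>lborel)
      = (\<integral>\<^sup>+y. ennreal (max 0 (y - a) - max 0 (y - b)) \<partial>N)"
    by (subst tail_fubini[symmetric]) (simp_all add: inner)
  also have "\<dots> = ennreal (\<integral>y. max 0 (y - a) - max 0 (y - b) \<partial>N)"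
    using assms by (intro nn_integral_eq_integral Bochner_Integration.integrable_diff integrable_pos_part) auto
  also have "(\<integral>y. max 0 (y - a) - max 0 (y - b) \<partial>N) = G a - G b"
    unfolding G_def by (rule Bochner_Integration.integral_diff) (rule integrable_pos_part)+
  finally show ?thesis .
qed

lemma set_integral_H: "(LBINT t:{0..}. H t) = G 0"
proof -
  have inner: "(\<integral>\<^sup>+s. indicator {0..} s * indicator {..<y} s \<partial>lborel) = ennreal (max 0 (y - 0))" for y :: real
  proof -
    have "(\<integral>\<^sup>+s. indicator {0..} s * indicator {..<y} s \<partial>lborel) = emeasure lborel ({0..} \<inter> {..<y})"
      by (simp add: indicator_inter_arith[symmetric] del: nn_integral_indicator) simp
    also have "{0..} \<inter> {..<y} = {0..<y}" by auto
    also have "emeasure lborel \<dots> = ennreal (max 0 (y - 0))"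
      by (cases "0 \<le> y") auto
    finally show ?thesis .
  qed
  have "(\<integral>\<^sup>+s. indicator {0..} s * ennreal (H s) \<partial>lborel) = (\<integral>\<^sup>+y. ennreal (max 0 (y - 0)) \<partial>N)"
    by (subst tail_fubini[symmetric]) (simp_all add: inner)
  also have "\<dots> = ennreal (G 0)"
    unfolding G_def by (intro nn_integral_eq_integral integrable_pos_part) auto
  finally have "(\<integral>\<^sup>+s. ennreal (indicator {0..} s *\<^sub>R H s) \<partial>lborel) = ennreal (G 0)"
    by (simp add: ennreal_mult' ennreal_indicator)
  then show ?thesis unfolding set_lebesgue_integral_def
    by (intro integral_eq_nn_integral[THEN trans]) (auto simp: H_nonneg G_nonneg)
qed

text \<open>Apply \<open>tail_fubini\<close> to \<open>H (z - s)\<close> on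
  \<open>[0, z - R]\<close>: its primitive at \<open>y \<ge> 0\<close> is
  \<open>G (max R (z - y)) - G z\<close>, because freezing \<open>G\<close> at \<open>R\<close>
  amounts to ending the integration at \<open>z - R\<close>. For \<open>y < 0\<close> the difference
  is not positive and \<open>ennreal\<close> sends it to 0, so only upward steps count here.\<close>

lemma convolution_nn_integral:
  assumes "R \<le> z"
  shows "(\<integral>\<^sup>+y. ennreal (G (max R (z - y)) - G z) \<partial>N)
      = (\<integral>\<^sup>+s. indicator {0..z - R} s * ennreal (H (z - s) * H s) \<partial>lborel)"
proof -
  have inner: "(\<integral>\<^sup>+s. (indicator {0..z - R} s * ennreal (H (z - s))) * indicator {..<y} s \<partial>lborel)
      = ennreal (G (max R (z - y)) - G z)" for y
  proof (cases "y \<ge> 0")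
    case True
    define a where "a = max R (z - y)"
    have az: "a \<le> z" and az': "z - a = min (z - R) y" using assms True by (auto simp: a_def)
    have "(\<integral>\<^sup>+s. (indicator {0..z - R} s * ennreal (H (z - s))) * indicator {..<y} s \<partial>lborel)
        = (\<integral>\<^sup>+s. indicator {0..z - a} s * ennreal (H (z - s)) \<partial>lborel)"
    proof (rule nn_integral_cong_AE)
      show "AE s in lborel. (indicator {0..z - R} s * ennreal (H (z - s))) * indicator {..<y} s
          = indicator {0..z - a} s * ennreal (H (z - s))"
        using AE_lborel_singleton[of y]
        by eventually_elim (auto simp: az' indicator_def)
    qed
    also have "\<dots> = (\<integral>\<^sup>+s. indicator {a..z} s * ennreal (H s) \<partial>lborel)"
      by (subst (2) nn_integral_real_affine[where c="-1" and t=z])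
        (auto intro!: nn_integral_cong simp: indicator_def)
    also have "\<dots> = ennreal (G a - G z)" by (rule G_diff_eq_nn_integral[OF az])
    finally show ?thesis by (simp add: a_def)
  next
    case False
    then have "G (max R (z - y)) - G z \<le> 0"
      using G_antimono[of z "max R (z - y)"] by auto
    moreover have "(\<integral>\<^sup>+s. (indicator {0..z - R} s * ennreal (H (z - s))) * indicator {..<y} s \<partial>lborel)
        = (\<integral>\<^sup>+s. 0 \<partial>(lborel::real measure))"
      using False by (intro nn_integral_cong) (auto simp: indicator_def)
    ultimately show ?thesis by (simp add: ennreal_neg)
  qed
  show ?thesis
    by (simp add: inner[symmetric], subst tail_fubini)
      (auto simp: ennreal_mult' H_nonneg mult.assoc)
qed

lemma conv_integrable: "set_integrable lborel {a..b} (\<lambda>s. H (z - s) * H s)"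
  unfolding set_integrable_def
proof (rule Bochner_Integration.integrable_bound)
  show "integrable lborel (indicator {a..b} :: real \<Rightarrow> real)"
    by (simp add: integrable_indicator_iff emeasure_lborel_Icc_eq)
qed (auto simp: indicator_def abs_mult H_nonneg H_le_1 intro!: mult_le_one)

text \<open>Removing the part of the convolution near \<open>z\<close>, where \<open>H s \<ge> H z\<close>, costs about half of
  the asymptotic value \<open>2 * G 0 * H z\<close>; this is what turns the positive mean into the mean of the step.\<close>

lemma truncated_conv_le:
  assumes "0 \<le> R" "R \<le> z"
  shows "(LBINT s:{0..z - R}. H (z - s) * H s)
    \<le> (LBINT s:{0..z}. H (z - s) * H s) - H z * (G 0 - G R)"
proof -
  have HI: "(LBINT s:{z-R..z}. H (z - s)) = G 0 - G R" and HIi: "set_integrable lborel {z-R..z} (\<lambda>s. H (z - s))"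
  proof -
    have "(\<integral>\<^sup>+s. ennreal (indicator {z-R..z} s *\<^sub>R H (z - s)) \<partial>lborel)
       = (\<integral>\<^sup>+s. indicator {0..R} s * ennreal (H s) \<partial>lborel)"
      by (subst (2) nn_integral_real_affine[where c="-1" and t=z])
        (auto intro!: nn_integral_cong simp: indicator_def)
    also have "\<dots> = ennreal (G 0 - G R)" by (rule G_diff_eq_nn_integral[OF assms(1)])
    finally have *: "(\<integral>\<^sup>+s. ennreal (indicator {z-R..z} s *\<^sub>R H (z - s)) \<partial>lborel) = ennreal (G 0 - G R)" .
    have "has_bochner_integral lborel (\<lambda>s. indicator {z-R..z} s *\<^sub>R H (z - s)) (G 0 - G R)"
      by (rule has_bochner_integral_nn_integral[OF _ _ _ *])
        (auto simp: H_nonneg G_antimono assms)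
    then show "(LBINT s:{z-R..z}. H (z - s)) = G 0 - G R" "set_integrable lborel {z-R..z} (\<lambda>s. H (z - s))"
      by (auto simp: set_integrable_def set_lebesgue_integral_def has_bochner_integral_iff)
  qed
  have "H z * (G 0 - G R) = (LBINT s:{z-R..z}. H (z - s) * H z)"
    by (simp add: HI)
  also have "\<dots> \<le> (LBINT s:{z-R..z}. H (z - s) * H s)"
    by (intro set_integral_mono set_integrable_mult_left HIi conv_integrable)
      (auto intro!: mult_left_mono H_antimono H_nonneg)
  finally have 1: "H z * (G 0 - G R) \<le> (LBINT s:{z-R..z}. H (z - s) * H s)" .
  have "(LBINT s:{0..z - R} \<union> {z-R..z}. H (z - s) * H s)
     = (LBINT s:{0..z - R}. H (z - s) * H s) + (LBINT s:{z-R..z}. H (z - s) * H s)"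
  proof (rule set_integral_Un_AE)
    show "AE x in lborel. \<not> (x \<in> {0..z - R} \<and> x \<in> {z - R..z})"
      using AE_lborel_singleton[of "z - R"] by eventually_elim auto
  qed (auto intro: conv_integrable)
  moreover have "{0..z - R} \<union> {z-R..z} = {0..z}" using assms by auto
  ultimately show ?thesis using 1 by simp
qed

lemma integrable_G_max: "integrable N (\<lambda>y. G (max R (z - y)))"
  by (rule integrable_const_bound[where B="G R"]) (auto simp: G_nonneg G_antimono)

text \<open>Upward steps contribute exactly the truncated convolution. A downward step lowers
  \<open>G\<close> by at least its size, capped at \<open>T\<close>, times \<open>H (z + T)\<close>.
  The cap keeps the argument within a fixed distance of \<open>z\<close>, so that long-tailedness
  can later replace \<open>H (z + T)\<close> by \<open>H z\<close>.\<close>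

lemma expectation_G_max_le:
  assumes "0 \<le> R" "R \<le> z" "0 \<le> T"
  shows "(\<integral>y. G (max R (z - y)) \<partial>N) \<le> G z + (LBINT s:{0..z - R}. H (z - s) * H s)
     - H (z + T) * (\<integral>y. min T (max 0 (- y)) \<partial>N)"
proof -
  let ?f = "\<lambda>y. G (max R (z - y)) - G z"
  have i1: "integrable N ?f" by (intro Bochner_Integration.integrable_diff integrable_G_max) auto
  then have i2: "integrable N (\<lambda>y. max 0 (?f y))" by (intro integrable_max) auto
  have i3: "integrable N (\<lambda>y. min T (max 0 (- y)))"
    using assms by (intro integrable_const_bound[where B=T]) auto
  have "ennreal (\<integral>y. max 0 (?f y) \<partial>N) = (\<integral>\<^sup>+y. ennreal (max 0 (?f y)) \<partial>N)"
    by (intro nn_integral_eq_integral[symmetric] i2) auto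
  also have "\<dots> = (\<integral>\<^sup>+y. ennreal (?f y) \<partial>N)"
    by (intro nn_integral_cong) (auto simp: max_def ennreal_neg)
  also have "\<dots> = (\<integral>\<^sup>+s. ennreal (indicator {0..z - R} s *\<^sub>R (H (z - s) * H s)) \<partial>lborel)"
    unfolding convolution_nn_integral[OF assms(2)] by (intro nn_integral_cong) (auto simp: indicator_def)
  also have "\<dots> = ennreal (LBINT s:{0..z - R}. H (z - s) * H s)"
    unfolding set_lebesgue_integral_def
    by (intro nn_integral_eq_integral conv_integrable[unfolded set_integrable_def])
      (auto simp: H_nonneg)
  finally have pos: "(\<integral>y. max 0 (?f y) \<partial>N) = (LBINT s:{0..z - R}. H (z - s) * H s)"
    by (subst (asm) ennreal_inj)
       (auto intro!: integral_nonneg_AE simp: set_lebesgue_integral_def H_nonneg)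
  have "(\<integral>y. ?f y \<partial>N) \<le> (\<integral>y. max 0 (?f y) - H (z + T) * min T (max 0 (- y)) \<partial>N)"
  proof (intro integral_mono i1 Bochner_Integration.integrable_diff i2 integrable_mult_right i3)
    fix y
    show "?f y \<le> max 0 (?f y) - H (z + T) * min T (max 0 (- y))"
    proof (cases "y \<ge> 0")
      case True
      then show ?thesis using assms by simp
    next
      case False
      define u where "u = min T (- y)"
      have u: "0 \<le> u" "u \<le> T" "u \<le> - y" using False assms by (auto simp: u_def)
      have "u * H (z + T) \<le> u * H (z + u)" using u by (intro mult_left_mono H_antimono) auto
      also have "\<dots> \<le> G z - G (z + u)" using G_diff_ge[of z "z + u"] u by simp
      also have "\<dots> \<le> G z - G (z - y)" using G_antimono[of "z + u" "z - y"] u by simp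
      also have "z - y = max R (z - y)" using False assms by auto
      finally have "H (z + T) * min T (max 0 (- y)) \<le> - ?f y"
        using False by (simp add: u_def mult.commute)
      then show ?thesis by linarith
    qed
  qed
  also have "\<dots> = (\<integral>y. max 0 (?f y) \<partial>N) - H (z + T) * (\<integral>y. min T (max 0 (- y)) \<partial>N)"
    by (subst Bochner_Integration.integral_diff) (auto intro: i2 i3)
  finally have "(\<integral>y. ?f y \<partial>N) \<le> \<dots>" .
  moreover have "(\<integral>y. ?f y \<partial>N) = (\<integral>y. G (max R (z - y)) \<partial>N) - G z"
    by (subst Bochner_Integration.integral_diff) (auto intro: integrable_G_max simp: prob_space[simplified])
  ultimately show ?thesis using pos by linarith
qed

text \<open>The limit is the mean of the negative part, computed from
  \<open>max 0 (- y) = max 0 y - y\<close>.\<close>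

lemma truncated_neg_part_tendsto: "((\<lambda>T. \<integral>y. min T (max 0 (- y)) \<partial>N) \<longlongrightarrow> G 0 + m) at_top"
proof -
  have i: "integrable N (\<lambda>y. max 0 (- y))" using integrable_id by (intro integrable_max) auto
  have "((\<lambda>T. \<integral>y. min T (max 0 (- y)) \<partial>N) \<longlongrightarrow> (\<integral>y. max 0 (- y) \<partial>N)) at_top"
  proof (rule integral_dominated_convergence_at_top[where w="\<lambda>y. max 0 (- y)"])
    show "AE y in N. ((\<lambda>T. min T (max 0 (- y))) \<longlongrightarrow> max 0 (- y)) at_top"
    proof (rule AE_I2)
      fix y :: real
      have "eventually (\<lambda>T. max 0 (- y) = min T (max 0 (- y))) at_top"
        using eventually_ge_at_top[of "max 0 (- y)"] by eventually_elim simp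
      then show "((\<lambda>T. min T (max 0 (- y))) \<longlongrightarrow> max 0 (- y)) at_top"
        by (rule Lim_transform_eventually[OF tendsto_const])
    qed
    show "\<forall>\<^sub>F T in at_top. AE y in N. norm (min T (max 0 (- y))) \<le> max 0 (- y)"
      using eventually_ge_at_top[of 0] by eventually_elim auto
  qed (auto intro: i)
  moreover have "(\<integral>y. max 0 (- y) \<partial>N) = (\<integral>y. max 0 (y - 0) - y \<partial>N)"
    by (intro Bochner_Integration.integral_cong) auto
  moreover have "\<dots> = G 0 + m"
    unfolding G_def
    by (subst Bochner_Integration.integral_diff) (auto intro: integrable_pos_part integrable_id simp del: diff_0_right simp: mean_eq)
  ultimately show ?thesis by simp
qed

end

text \<open>\<open>H_conv\<close> is the condition defining the class, with \<open>mean_plus\<close>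
  already rewritten as \<open>G 0\<close>; \<open>set_integral_H\<close> justifies this.\<close>

locale strong_subexponential_distribution = negative_mean_distribution +
  assumes H_pos: "H x > 0"
    and H_shift: "c > 0 \<Longrightarrow> ((\<lambda>x. H (x - c) / H x) \<longlongrightarrow> 1) at_top"
    and H_conv: "(\<lambda>z. LBINT s:{0..z}. H (z - s) * H s) \<sim>[at_top] (\<lambda>z. 2 * G 0 * H z)"
begin

lemma H_shift_any: "((\<lambda>x. H (x + c) / H x) \<longlongrightarrow> 1) at_top"
proof -
  consider "c < 0" | "c = 0" | "c > 0" by linarith
  then show ?thesis
  proof cases
    case 1
    then show ?thesis using H_shift[of "- c"] by simp
  next
    case 2
    then show ?thesis using H_pos by (auto simp: less_imp_neq[THEN not_sym])
  next
    case 3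
    have "filterlim (\<lambda>x. x + c) at_top (at_top :: real filter)"
      using filterlim_tendsto_add_at_top[OF tendsto_const[of c] filterlim_ident] by (simp add: add.commute)
    from filterlim_compose[OF H_shift[OF 3] this]
    have "((\<lambda>x. H x / H (x + c)) \<longlongrightarrow> 1) at_top" by simp
    then have "((\<lambda>x. inverse (H x / H (x + c))) \<longlongrightarrow> inverse 1) at_top"
      by (intro tendsto_inverse) auto
    then show ?thesis by (simp add: inverse_eq_divide)
  qed
qed

lemma G_pos: "G x > 0"
  using G_diff_ge[of x "x + 1"] H_pos[of "x + 1"] G_nonneg[of "x + 1"] by simp

lemma H_conv_ratio: "((\<lambda>z. (LBINT s:{0..z}. H (z - s) * H s) / H z) \<longlongrightarrow> 2 * G 0) at_top"
proof -
  have "((\<lambda>z. (LBINT s:{0..z}. H (z - s) * H s) / (2 * G 0 * H z)) \<longlongrightarrow> 1) at_top"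
    by (rule asymp_equivD_strong[OF H_conv]) (use H_pos G_pos in \<open>auto simp: less_imp_neq[THEN not_sym]\<close>)
  from tendsto_mult_right[OF this, of "2 * G 0"] show ?thesis
    using G_pos[of 0] by simp
qed

text \<open>In units of \<open>H z\<close>, upward steps gain \<open>2 * G 0 - (G 0 - G R)\<close>
  and downward steps lose \<open>G 0 + m\<close>, leaving \<open>G R - m\<close>. The tolerance
  \<open>d\<close> is spent in quarters: on \<open>G R\<close>, on the cap \<open>T\<close>, on the
  shift from \<open>z + T\<close> to \<open>z\<close>, and on the convolution asymptotics. So
  \<open>R\<close> and \<open>T\<close> are fixed before \<open>z\<close> is made large.\<close>

lemma drift:
  assumes "d > 0"
  obtains R z0 where "0 \<le> R" "R \<le> z0"
    "\<And>z. z \<ge> z0 \<Longrightarrow> (\<integral>y. G (max R (z - y)) \<partial>N) \<le> G z - (m - d) * H z"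
proof -
  have "eventually (\<lambda>R. G R < d / 4) at_top"
    using order_tendstoD(2)[OF G_tendsto_0, of "d / 4"] assms by simp
  then obtain R where R: "0 \<le> R" "G R < d / 4"
    using eventually_ge_at_top[of 0] by (metis (mono_tags, lifting) eventually_conj eventually_happens' trivial_limit_at_top_linorder)
  define e where "e T = (\<integral>y. min T (max 0 (- y)) \<partial>N)" for T
  have "eventually (\<lambda>T. e T > G 0 + m - d / 4) at_top"
    using order_tendstoD(1)[OF truncated_neg_part_tendsto, of "G 0 + m - d / 4"] assms by (simp add: e_def)
  then obtain T where T: "0 \<le> T" "e T > G 0 + m - d / 4"
    using eventually_ge_at_top[of 0] by (metis (mono_tags, lifting) eventually_conj eventually_happens' trivial_limit_at_top_linorder)
  have "((\<lambda>z. H (z + T) / H z * e T) \<longlongrightarrow> 1 * e T) at_top"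
    by (intro tendsto_mult H_shift_any tendsto_const)
  then have ev1: "eventually (\<lambda>z. H (z + T) / H z * e T > e T - d / 4) at_top"
    using assms by (auto dest!: order_tendstoD(1)[where a="e T - d / 4"])
  have ev2: "eventually (\<lambda>z. (LBINT s:{0..z}. H (z - s) * H s) / H z < 2 * G 0 + d / 4) at_top"
    using order_tendstoD(2)[OF H_conv_ratio] assms by simp
  have "eventually (\<lambda>z. z \<ge> R \<and> (\<integral>y. G (max R (z - y)) \<partial>N) \<le> G z - (m - d) * H z) at_top"
    using ev1 ev2 eventually_ge_at_top[of R]
  proof eventually_elim
    case (elim z)
    have a: "(e T - d / 4) * H z \<le> H (z + T) * e T"
      using elim(1) H_pos[of z] by (simp add: field_simps)
    have b: "(LBINT s:{0..z}. H (z - s) * H s) \<le> (2 * G 0 + d / 4) * H z"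
      using elim(2) H_pos[of z] by (simp add: field_simps)
    have "(\<integral>y. G (max R (z - y)) \<partial>N) \<le> G z + (LBINT s:{0..z - R}. H (z - s) * H s) - H (z + T) * e T"
      unfolding e_def by (rule expectation_G_max_le) (use R T elim in auto)
    also have "\<dots> \<le> G z + ((2 * G 0 + d / 4) * H z - H z * (G 0 - G R)) - (e T - d / 4) * H z"
      using truncated_conv_le[OF R(1) elim(3)] a b by linarith
    also have "\<dots> = G z + (G 0 + G R + d / 2 - e T) * H z" by (simp add: algebra_simps)
    also have "\<dots> \<le> G z + (d - m) * H z"
      using R T H_nonneg[of z] by (intro add_left_mono mult_right_mono) auto
    finally show ?case using elim by (simp add: algebra_simps)
  qed
  then obtain z0 where "\<forall>z\<ge>z0. z \<ge> R \<and> (\<integral>y. G (max R (z - y)) \<partial>N) \<le> G z - (m - d) * H z"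
    by (auto simp: eventually_at_top_linorder)
  then show ?thesis using R by (intro that[of R z0]) auto
qed

end

section \<open>The stopped walk and averaging over the next step\<close>

text \<open>Increments are indexed by \<open>Suc n\<close> since \<open>\<xi> 0\<close> does not
  enter the walk. By \<open>stopping\<close>, whether step \<open>Suc n\<close> is taken is known at
  time \<open>n\<close>; by \<open>indep_future\<close>, that step can then be averaged on its
  own.\<close>

locale stopped_walk =
  prob_space M + step: strong_subexponential_distribution "distr M borel (\<xi> (Suc 0))" m
  for M :: "'a measure" and \<xi> :: "nat \<Rightarrow> 'a \<Rightarrow> real" and m :: real +
  fixes Fl :: "nat \<Rightarrow> 'a measure" and \<sigma> :: "'a \<Rightarrow> enat"
  assumes ident: "\<And>n. distr M borel (\<xi> (Suc n)) = distr M borel (\<xi> (Suc 0))"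
    and filt: "filtration (space M) Fl"
    and filt_sub: "\<And>n. sets (Fl n) \<subseteq> sets M"
    and adapted: "\<And>n. \<xi> (Suc n) \<in> borel_measurable (Fl (Suc n))"
    and indep_future: "\<And>n. indep_set (sets (Fl n))
                          {\<xi> (Suc n) -` A \<inter> space M | A. A \<in> sets borel}"
    and stopping: "\<And>n::nat. Measurable.pred (Fl n) (\<lambda>\<omega>. \<sigma> \<omega> \<le> enat n)"
begin

abbreviation "N \<equiv> distr M borel (\<xi> (Suc 0))"
abbreviation "H \<equiv> step.H"
abbreviation "G \<equiv> step.G"
abbreviation "S \<equiv> rw \<xi>"

lemma space_Fl [simp]: "space (Fl n) = space M"
  using filt by (rule filtration.space_F)

lemma Fl_mono: "k \<le> n \<Longrightarrow> sets (Fl k) \<subseteq> sets (Fl n)"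
  using filt by (rule filtration.sets_F_mono)

lemma measurable_from_Fl: "f \<in> measurable (Fl n) A \<Longrightarrow> f \<in> measurable M A"
  by (rule measurable_from_subalg[rotated]) (use filt_sub in \<open>auto simp: subalgebra_def\<close>)

lemma measurable_Fl_mono: "f \<in> measurable (Fl k) A \<Longrightarrow> k \<le> n \<Longrightarrow> f \<in> measurable (Fl n) A"
  by (rule measurable_from_subalg[rotated]) (auto simp: subalgebra_def dest: Fl_mono)

lemma increment_measurable [measurable]: "\<xi> (Suc n) \<in> borel_measurable M"
  by (rule measurable_from_Fl[OF adapted])

lemma S_0 [simp]: "S 0 \<omega> = 0" and S_Suc: "S (Suc n) \<omega> = S n \<omega> + \<xi> (Suc n) \<omega>"
  by (simp_all add: rw_def)

lemma S_adapted: "k \<le> n \<Longrightarrow> S k \<in> borel_measurable (Fl n)"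
proof (induction k)
  case 0
  then show ?case by (simp add: rw_def[abs_def])
next
  case (Suc k)
  then have [measurable]: "S k \<in> borel_measurable (Fl n)" "\<xi> (Suc k) \<in> borel_measurable (Fl n)"
    using measurable_Fl_mono[OF adapted] by auto
  show ?case unfolding S_Suc[abs_def] by measurable
qed

lemma S_measurable [measurable]: "S k \<in> borel_measurable M"
  by (rule measurable_from_Fl[OF S_adapted[OF order_refl]])

lemma alive_adapted: "k \<le> n \<Longrightarrow> Measurable.pred (Fl n) (\<lambda>\<omega>. enat k < \<sigma> \<omega>)"
  using pred_intros_logic(2)[OF measurable_Fl_mono[OF stopping], of k n] by (simp add: not_le)

lemma alive_measurable [measurable]: "Measurable.pred M (\<lambda>\<omega>. enat k < \<sigma> \<omega>)"
  by (rule measurable_from_Fl[OF alive_adapted[OF order_refl]])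

lemma reached_measurable [measurable]: "Measurable.pred M (\<lambda>\<omega>. enat k \<le> \<sigma> \<omega>)"
proof (cases k)
  case 0
  then show ?thesis by (simp flip: zero_enat_def)
next
  case (Suc j)
  then show ?thesis using alive_measurable[of j] by (simp add: Suc_ile_eq)
qed

lemma integral_increment: "f \<in> borel_measurable borel \<Longrightarrow> (\<integral>\<omega>. f (\<xi> (Suc n) \<omega>) \<partial>M) = (\<integral>y. f y \<partial>N)"
  for f :: "real \<Rightarrow> real"
  by (subst ident[of n, symmetric], subst integral_distr) auto

lemma integrable_increment_fun:
  fixes f :: "real \<Rightarrow> real"
  assumes "integrable N f"
  shows "integrable M (\<lambda>\<omega>. f (\<xi> (Suc n) \<omega>))"
proof -
  have "f \<in> borel_measurable borel" using borel_measurable_integrable[OF assms] by simp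
  moreover have "integrable (distr M borel (\<xi> (Suc n))) f" by (subst ident) (rule assms)
  ultimately show ?thesis by (subst (asm) integrable_distr_eq) auto
qed

lemma integrable_increment: "integrable M (\<xi> (Suc n))"
  using integrable_increment_fun[OF step.integrable_id] .

lemma integrable_S: "integrable M (S n)"
proof (induction n)
  case 0
  then show ?case by (simp add: rw_def[abs_def])
next
  case (Suc n)
  then show ?case unfolding S_Suc[abs_def] by (intro Bochner_Integration.integrable_add integrable_increment)
qed

text \<open>\<open>distr M (Fl n) (\<lambda>\<omega>. \<omega>)\<close> is \<open>M\<close>
  restricted to the past. Independence gives the product formula on rectangles, and these determine
  the joint law.\<close>

lemma joint_distr:
  "distr M (Fl n) (\<lambda>\<omega>. \<omega>) \<Otimes>\<^sub>M N = distr M (Fl n \<Otimes>\<^sub>M borel) (\<lambda>\<omega>. (\<omega>, \<xi> (Suc n) \<omega>))"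
proof -
  let ?D = "distr M (Fl n) (\<lambda>\<omega>. \<omega>)"
  have id [measurable]: "(\<lambda>\<omega>. \<omega>) \<in> measurable M (Fl n)"
    by (rule measurable_from_Fl[of _ n]) simp
  interpret D: prob_space ?D by (rule prob_space_distr) simp
  interpret P: pair_prob_space ?D N ..
  show ?thesis
  proof (rule pair_measure_eqI)
    fix A B assume A: "A \<in> sets ?D" and B: "B \<in> sets N"
    then have AF [measurable]: "A \<in> sets (Fl n)" and BB [measurable]: "B \<in> sets borel" by auto
    have As: "A \<subseteq> space M" using sets.sets_into_space[OF AF] by simp
    have "prob (A \<inter> (\<xi> (Suc n) -` B \<inter> space M)) = prob A * prob (\<xi> (Suc n) -` B \<inter> space M)"
      by (rule indep_setD[OF indep_future]) (use AF BB in auto)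
    moreover have "emeasure ?D A = ennreal (prob A)"
      using As by (subst emeasure_distr) (auto simp: emeasure_eq_measure Int_absorb2)
    moreover have "emeasure N B = ennreal (prob (\<xi> (Suc n) -` B \<inter> space M))"
      by (subst ident[of n, symmetric], subst emeasure_distr) (auto simp: emeasure_eq_measure)
    moreover have "emeasure (distr M (Fl n \<Otimes>\<^sub>M borel) (\<lambda>\<omega>. (\<omega>, \<xi> (Suc n) \<omega>))) (A \<times> B)
        = emeasure M ((\<lambda>\<omega>. (\<omega>, \<xi> (Suc n) \<omega>)) -` (A \<times> B) \<inter> space M)"
      by (rule emeasure_distr) auto
    moreover have "(\<lambda>\<omega>. (\<omega>, \<xi> (Suc n) \<omega>)) -` (A \<times> B) \<inter> space M = A \<inter> (\<xi> (Suc n) -` B \<inter> space M)"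
      using As by auto
    ultimately show "emeasure ?D A * emeasure N B = emeasure (distr M (Fl n \<Otimes>\<^sub>M borel) (\<lambda>\<omega>. (\<omega>, \<xi> (Suc n) \<omega>))) (A \<times> B)"
      by (simp add: emeasure_eq_measure ennreal_mult)
  qed (auto intro!: sets_pair_measure_cong simp: D.sigma_finite_measure_axioms step.sigma_finite_measure_axioms)
qed

text \<open>Conditioning on \<open>Fl n\<close> in the form of Fubini: the past is frozen and the
  next step integrated out, which avoids conditional expectations.\<close>

lemma one_step:
  fixes h :: "'a \<times> real \<Rightarrow> real"
  assumes h [measurable]: "h \<in> borel_measurable (Fl n \<Otimes>\<^sub>M borel)" and bound: "\<And>p. \<bar>h p\<bar> \<le> c"
  shows "(\<integral>\<omega>. h (\<omega>, \<xi> (Suc n) \<omega>) \<partial>M) = (\<integral>\<omega>. (\<integral>y. h (\<omega>, y) \<partial>N) \<partial>M)"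
proof -
  let ?D = "distr M (Fl n) (\<lambda>\<omega>. \<omega>)"
  have id [measurable]: "(\<lambda>\<omega>. \<omega>) \<in> measurable M (Fl n)"
    by (rule measurable_from_Fl[of _ n]) simp
  interpret D: prob_space ?D by (rule prob_space_distr) simp
  interpret P: pair_prob_space ?D N ..
  have eq: "?D \<Otimes>\<^sub>M N = distr M (Fl n \<Otimes>\<^sub>M borel) (\<lambda>\<omega>. (\<omega>, \<xi> (Suc n) \<omega>))"
    by (rule joint_distr)
  have [measurable]: "h \<in> borel_measurable (?D \<Otimes>\<^sub>M N)"
    using h by (simp cong: measurable_cong_sets)
  have "(\<integral>\<omega>. h (\<omega>, \<xi> (Suc n) \<omega>) \<partial>M) = integral\<^sup>L (?D \<Otimes>\<^sub>M N) h"
    unfolding eq by (subst integral_distr) auto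
  also have "\<dots> = (\<integral>\<omega>. (\<integral>y. h (\<omega>, y) \<partial>N) \<partial>?D)"
    by (rule P.integral_fst'[symmetric]) (rule P.P.integrable_const_bound[where B=c], use bound in auto)
  also have "\<dots> = (\<integral>\<omega>. (\<integral>y. h (\<omega>, y) \<partial>N) \<partial>M)"
  proof (rule integral_distr)
    have "(\<lambda>\<omega>. (\<integral>y. h (\<omega>, y) \<partial>N)) \<in> borel_measurable ?D"
      by measurable
    then show "(\<lambda>\<omega>. (\<integral>y. h (\<omega>, y) \<partial>N)) \<in> borel_measurable (Fl n)"
      by (simp cong: measurable_cong_sets)
  qed simp
  finally show ?thesis .
qed

lemma jump_prob:
  assumes B: "B \<in> sets (Fl n)" and T [measurable]: "T \<in> borel_measurable (Fl n)"
  shows "prob {\<omega>\<in>B. T \<omega> < \<xi> (Suc n) \<omega>} = (\<integral>\<omega>. indicator B \<omega> * H (T \<omega>) \<partial>M)"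
proof -
  note B [measurable]
  have [measurable]: "B \<in> sets M" using B filt_sub by blast
  have [measurable]: "T \<in> borel_measurable M" by (rule measurable_from_Fl[of _ n]) simp
  have Bs: "B \<subseteq> space M" by (rule sets.sets_into_space) simp
  have "prob {\<omega>\<in>B. T \<omega> < \<xi> (Suc n) \<omega>} = (\<integral>\<omega>. indicator {\<omega>\<in>space M. \<omega> \<in> B \<and> T \<omega> < \<xi> (Suc n) \<omega>} \<omega> \<partial>M)"
  proof -
    have "{\<omega>\<in>B. T \<omega> < \<xi> (Suc n) \<omega>} = {\<omega>\<in>space M. \<omega> \<in> B \<and> T \<omega> < \<xi> (Suc n) \<omega>} \<inter> space M"
      using Bs by auto
    then show ?thesis by simp
  qed
  also have "\<dots> = (\<integral>\<omega>. (\<lambda>p. indicator B (fst p) * indicator {p. T (fst p) < snd p} p) (\<omega>, \<xi> (Suc n) \<omega>) \<partial>M)"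
    using Bs by (intro Bochner_Integration.integral_cong) (auto simp: indicator_def)
  also have "\<dots> = (\<integral>\<omega>. (\<integral>y. (\<lambda>p. indicator B (fst p) * indicator {p. T (fst p) < snd p} p) (\<omega>, y) \<partial>N) \<partial>M)"
  proof (rule one_step[where c=1])
    have [measurable]: "Measurable.pred (Fl n \<Otimes>\<^sub>M borel) (\<lambda>p. T (fst p) < snd p)" by measurable
    have "indicator {p. T (fst p) < snd p} = (\<lambda>p. if T (fst p) < snd p then 1 else 0 :: real)" by auto
    then show "(\<lambda>p. indicator B (fst p) * indicator {p. T (fst p) < snd p} p :: real) \<in> borel_measurable (Fl n \<Otimes>\<^sub>M borel)"
      by simp
  qed (auto simp: indicator_def)
  also have "\<dots> = (\<integral>\<omega>. indicator B \<omega> * H (T \<omega>) \<partial>M)"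
  proof (rule Bochner_Integration.integral_cong)
    fix \<omega>
    have "(\<integral>y. indicator {p. T (fst p) < snd p} (\<omega>, y) \<partial>N) = (\<integral>y. indicator {T \<omega><..} y \<partial>N :: real)"
      by (intro Bochner_Integration.integral_cong) (auto simp: indicator_def)
    also have "\<dots> = H (T \<omega>)" by (simp add: step.H_def del: integral_indicator)
    finally show "(\<integral>y. (\<lambda>p. indicator B (fst p) * indicator {p. T (fst p) < snd p} p) (\<omega>, y) \<partial>N) = indicator B \<omega> * H (T \<omega>)"
      by simp
  qed simp
  finally show ?thesis .
qed

text \<open>The drift inequality, applied pointwise with \<open>z = T \<omega>\<close> after
  \<open>one_step\<close>. It is available only from \<open>z0\<close> on, hence the restriction to
  an event \<open>B\<close> of the past on which \<open>T\<close> is at least \<open>z0\<close>;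
  there \<open>max R (T \<omega>)\<close> is just \<open>T \<omega>\<close>.\<close>

lemma drift_step:
  assumes dr: "\<And>z. z \<ge> z0 \<Longrightarrow> (\<integral>y. G (max R (z - y)) \<partial>N) \<le> G z - c * H z"
    and B: "B \<in> sets (Fl n)" and T [measurable]: "T \<in> borel_measurable (Fl n)"
    and TB: "\<And>\<omega>. \<omega> \<in> B \<Longrightarrow> z0 \<le> T \<omega>" and R: "R \<le> z0"
  shows "(\<integral>\<omega>. indicator B \<omega> * G (max R (T \<omega> - \<xi> (Suc n) \<omega>)) \<partial>M)
    \<le> (\<integral>\<omega>. indicator B \<omega> * G (max R (T \<omega>)) \<partial>M) - c * (\<integral>\<omega>. indicator B \<omega> * H (T \<omega>) \<partial>M)"
proof -
  note B [measurable]
  have [measurable]: "B \<in> sets M" using B filt_sub by blast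
  have [measurable]: "T \<in> borel_measurable M" by (rule measurable_from_Fl[of _ n]) simp
  have "(\<integral>\<omega>. (\<lambda>p. indicator B (fst p) * G (max R (T (fst p) - snd p))) (\<omega>, \<xi> (Suc n) \<omega>) \<partial>M)
    = (\<integral>\<omega>. (\<integral>y. (\<lambda>p. indicator B (fst p) * G (max R (T (fst p) - snd p))) (\<omega>, y) \<partial>N) \<partial>M)"
    by (rule one_step[where c="G R"]) (auto simp: indicator_def step.G_nonneg step.G_antimono)
  then have eq: "(\<integral>\<omega>. indicator B \<omega> * G (max R (T \<omega> - \<xi> (Suc n) \<omega>)) \<partial>M)
    = (\<integral>\<omega>. indicator B \<omega> * (\<integral>y. G (max R (T \<omega> - y)) \<partial>N) \<partial>M)" by simp
  have i1: "integrable M (\<lambda>\<omega>. indicator B \<omega> * G (max R (T \<omega>)))"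
    by (rule integrable_const_bound[where B="G R"]) (auto simp: indicator_def step.G_nonneg step.G_antimono)
  have i2: "integrable M (\<lambda>\<omega>. indicator B \<omega> * H (T \<omega>))"
    by (rule integrable_const_bound[where B=1]) (auto simp: indicator_def step.H_nonneg step.H_le_1)
  have "(\<integral>\<omega>. indicator B \<omega> * (\<integral>y. G (max R (T \<omega> - y)) \<partial>N) \<partial>M)
     \<le> (\<integral>\<omega>. indicator B \<omega> * G (max R (T \<omega>)) - c * (indicator B \<omega> * H (T \<omega>)) \<partial>M)"
  proof (rule integral_mono)
    have bd: "\<bar>\<integral>y. G (max R (t - y)) \<partial>N\<bar> \<le> G R" for t
    proof -
      have "(\<integral>y. G (max R (t - y)) \<partial>N) \<le> (\<integral>y. G R \<partial>N)"
        by (intro integral_mono step.integrable_G_max) (auto simp: step.G_antimono)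
      moreover have "0 \<le> (\<integral>y. G (max R (t - y)) \<partial>N)"
        by (intro integral_nonneg_AE) (auto simp: step.G_nonneg)
      ultimately show ?thesis by (simp add: step.prob_space[simplified])
    qed
    show "integrable M (\<lambda>\<omega>. indicator B \<omega> * (\<integral>y. G (max R (T \<omega> - y)) \<partial>N))"
      by (rule integrable_const_bound[where B="G R"]) (use bd in \<open>auto simp: indicator_def step.G_nonneg abs_mult\<close>)
    show "integrable M (\<lambda>\<omega>. indicator B \<omega> * G (max R (T \<omega>)) - c * (indicator B \<omega> * H (T \<omega>)))"
      by (intro Bochner_Integration.integrable_diff i1 integrable_mult_right i2)
    fix \<omega>
    show "indicator B \<omega> * (\<integral>y. G (max R (T \<omega> - y)) \<partial>N) \<le> indicator B \<omega> * G (max R (T \<omega>)) - c * (indicator B \<omega> * H (T \<omega>))"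
    proof (cases "\<omega> \<in> B")
      case True
      then have "max R (T \<omega>) = T \<omega>" using TB[OF True] R by auto
      then show ?thesis using dr[OF TB[OF True]] True by simp
    qed simp
  qed
  also have "\<dots> = (\<integral>\<omega>. indicator B \<omega> * G (max R (T \<omega>)) \<partial>M) - c * (\<integral>\<omega>. indicator B \<omega> * H (T \<omega>) \<partial>M)"
    by (subst Bochner_Integration.integral_diff) (auto intro: i1 i2)
  finally show ?thesis using eq by simp
qed

text \<open>Prepares \<open>past_times_step\<close>: the step itself is unbounded and so out of
  reach of \<open>one_step\<close>, but the product rule for independent integrable variables covers
  it.\<close>

lemma indep_var_indicator:
  assumes B: "B \<in> sets (Fl n)"
  shows "indep_var borel (indicator B :: 'a \<Rightarrow> real) borel (\<xi> (Suc n))"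
  unfolding indep_var_eq
proof (intro conjI)
  have BM [measurable]: "B \<in> sets M" using B filt_sub by blast
  show "random_variable borel (indicator B :: 'a \<Rightarrow> real)" "random_variable borel (\<xi> (Suc n))" by simp_all
  have past: "sigma_sets (space M) {(indicator B :: 'a \<Rightarrow> real) -` A \<inter> space M |A. A \<in> sets borel} \<subseteq> sets (Fl n)"
  proof (rule sigma_algebra.sigma_sets_subset)
    show "sigma_algebra (space M) (sets (Fl n))"
      using sets.sigma_algebra_axioms[of "Fl n"] by simp
    show "{(indicator B :: 'a \<Rightarrow> real) -` A \<inter> space M |A. A \<in> sets borel} \<subseteq> sets (Fl n)"
      using measurable_sets[OF borel_measurable_indicator[OF B]] by auto
  qed
  \<comment> \<open>The preimages of Borel sets already form a sigma-algebra, so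
    \<open>indep_future\<close> applies to the generated one.\<close>
  have future: "sigma_sets (space M) {\<xi> (Suc n) -` A \<inter> space M |A. A \<in> sets borel}
    = {\<xi> (Suc n) -` A \<inter> space M |A. A \<in> sets borel}"
    using sigma_sets_vimage_commute[of "\<xi> (Suc n)" "space M" UNIV "sets borel"] sets.sigma_sets_eq[of "borel :: real measure"]
    by simp
  show "indep_set (sigma_sets (space M) {(indicator B :: 'a \<Rightarrow> real) -` A \<inter> space M |A. A \<in> sets borel})
     (sigma_sets (space M) {\<xi> (Suc n) -` A \<inter> space M |A. A \<in> sets borel})"
    unfolding future using indep_future[of n] subsetD[OF past] unfolding indep_sets2_eq by blast
qed

lemma past_times_step:
  fixes f :: "real \<Rightarrow> real"
  assumes B: "B \<in> sets (Fl n)" and f: "integrable N f"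
  shows "(\<integral>\<omega>. indicator B \<omega> * f (\<xi> (Suc n) \<omega>) \<partial>M) = prob B * (\<integral>y. f y \<partial>N)"
    and "integrable M (\<lambda>\<omega>. indicator B \<omega> * f (\<xi> (Suc n) \<omega>))"
proof -
  have BM [measurable]: "B \<in> sets M" using B filt_sub by blast
  have fm: "f \<in> borel_measurable borel" using borel_measurable_integrable[OF f] by simp
  have "indep_var borel ((\<lambda>y. y) \<circ> (indicator B :: 'a \<Rightarrow> real)) borel (f \<circ> \<xi> (Suc n))"
    by (rule indep_var_compose[OF indep_var_indicator[OF B]]) (use fm in auto)
  then have iv: "indep_var borel (indicator B :: 'a \<Rightarrow> real) borel (\<lambda>\<omega>. f (\<xi> (Suc n) \<omega>))"
    by (simp add: comp_def)
  have i: "integrable M (indicator B :: 'a \<Rightarrow> real)"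
    by (simp add: integrable_indicator_iff emeasure_eq_measure)
  show "(\<integral>\<omega>. indicator B \<omega> * f (\<xi> (Suc n) \<omega>) \<partial>M) = prob B * (\<integral>y. f y \<partial>N)"
    using indep_var_lebesgue_integral[OF iv i integrable_increment_fun[OF f]] integral_increment[OF fm, of n] by simp
  show "integrable M (\<lambda>\<omega>. indicator B \<omega> * f (\<xi> (Suc n) \<omega>))"
    using indep_var_integrable[OF iv i integrable_increment_fun[OF f]] .
qed

section \<open>First-passage decomposition\<close>

text \<open>The strict \<open>enat n < \<sigma> \<omega>\<close> means that step
  \<open>Suc n\<close> is still taken, so a passage at time \<open>Suc n\<close> counts for the
  stopped maximum although \<open>below\<close> is decided at time \<open>n\<close>.\<close>

definition below :: "real \<Rightarrow> nat \<Rightarrow> 'a set" where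
  "below l n = {\<omega> \<in> space M. enat n < \<sigma> \<omega> \<and> (\<forall>i\<le>n. S i \<omega> \<le> l)}"

text \<open>The event that the stopped maximum is above \<open>x\<close>, without the supremum in
  \<open>ereal\<close>.\<close>

definition exceed :: "real \<Rightarrow> 'a set" where
  "exceed x = {\<omega> \<in> space M. \<exists>k. enat k \<le> \<sigma> \<omega> \<and> x < S k \<omega>}"

lemma below_sets [measurable]: "below l n \<in> sets (Fl n)"
proof -
  have [measurable]: "Measurable.pred (Fl n) (\<lambda>\<omega>. enat n < \<sigma> \<omega>)"
    by (rule alive_adapted) simp
  have [measurable]: "Measurable.pred (Fl n) (\<lambda>\<omega>. \<forall>i\<in>{..n}. S i \<omega> \<le> l)"
  proof (rule pred_intros_finite)
    fix i assume "i \<in> {..n}"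
    then have [measurable]: "S i \<in> borel_measurable (Fl n)" by (simp add: S_adapted)
    show "Measurable.pred (Fl n) (\<lambda>\<omega>. S i \<omega> \<le> l)" by measurable
  qed simp
  have "{\<omega> \<in> space (Fl n). enat n < \<sigma> \<omega> \<and> (\<forall>i\<in>{..n}. S i \<omega> \<le> l)} \<in> sets (Fl n)" by measurable
  then show ?thesis by (simp only: below_def space_Fl Ball_def atMost_iff)
qed

lemma below_events [measurable]: "below l n \<in> events"
  using below_sets filt_sub by blast

lemma exceed_events [measurable]: "exceed x \<in> events"
  unfolding exceed_def by measurable

lemma below_Suc_subset: "below l (Suc n) \<subseteq> below l n"
  by (auto simp: below_def intro: less_trans[of "enat n" "enat (Suc n)"])

text \<open>Splits by the first time the walk is above \<open>l\<close>. This time is not 0 because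
  \<open>S 0 = 0 \<le> l\<close>, so it is some \<open>Suc n\<close>, and the walk is in
  \<open>below l n\<close> just before.\<close>

lemma exceed_eq_UN:
  assumes "0 \<le> l"
  shows "(\<Union>n. {\<omega> \<in> below l n. l < S (Suc n) \<omega>}) = exceed l"
proof (intro set_eqI iffI)
  fix \<omega> assume "\<omega> \<in> exceed l"
  then obtain k where k: "\<omega> \<in> space M" "enat k \<le> \<sigma> \<omega>" "l < S k \<omega>" by (auto simp: exceed_def)
  define j where "j = (LEAST j. l < S j \<omega>)"
  have j: "l < S j \<omega>" "j \<le> k" and least: "\<And>i. i < j \<Longrightarrow> S i \<omega> \<le> l"
    using LeastI[of "\<lambda>j. l < S j \<omega>" k] Least_le[of "\<lambda>j. l < S j \<omega>" k] k not_less_Least[of _ "\<lambda>j. l < S j \<omega>"]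
    by (auto simp: j_def not_less)
  have "j \<noteq> 0" using j assms by (cases j) auto
  then obtain n where n: "j = Suc n" by (cases j) auto
  have "enat n < enat k" using j n by simp
  also note k(2)
  finally have "\<omega> \<in> {\<omega> \<in> below l n. l < S (Suc n) \<omega>}" using k j least n by (auto simp: below_def)
  then show "\<omega> \<in> (\<Union>n. {\<omega> \<in> below l n. l < S (Suc n) \<omega>})" by blast
qed (auto simp: exceed_def below_def Suc_ile_eq[symmetric])

lemma passage_sums:
  assumes "0 \<le> l"
  shows "(\<lambda>n. prob {\<omega> \<in> below l n. l < S (Suc n) \<omega>}) sums prob (exceed l)"
proof -
  let ?E = "\<lambda>n. {\<omega> \<in> below l n. l < S (Suc n) \<omega>}"
  have "?E n = {\<omega> \<in> space M. \<omega> \<in> below l n \<and> l < S (Suc n) \<omega>}" for n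
    by (auto simp: below_def)
  moreover have "\<dots> n \<in> events" for n by measurable
  ultimately have "range ?E \<subseteq> events" by auto
  moreover have "disjoint_family ?E"
    unfolding disjoint_family_on_def
  proof (intro ballI impI)
    fix i j :: nat assume "i \<noteq> j"
    then have "Suc i \<le> j \<or> Suc j \<le> i" by auto
    then show "?E i \<inter> ?E j = {}"
    proof
      assume "Suc i \<le> j"
      then have "S (Suc i) \<omega> \<le> l" if "\<omega> \<in> below l j" for \<omega> using that by (auto simp: below_def)
      then show ?thesis by force
    next
      assume "Suc j \<le> i"
      then have "S (Suc j) \<omega> \<le> l" if "\<omega> \<in> below l i" for \<omega> using that by (auto simp: below_def)
      then show ?thesis by force
    qed
  qed
  ultimately have "(\<lambda>n. prob (?E n)) sums prob (\<Union>n. ?E n)"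
    by (rule finite_measure_UNION)
  also have "(\<Union>n. ?E n) = exceed l" by (rule exceed_eq_UN[OF assms])
  finally show ?thesis .
qed

lemma jump_from_below:
  "prob {\<omega> \<in> below l n. t < S (Suc n) \<omega>} = (\<integral>\<omega>. indicator (below l n) \<omega> * H (t - S n \<omega>) \<partial>M)"
proof -
  have [measurable]: "S n \<in> borel_measurable (Fl n)" by (rule S_adapted) simp
  have "{\<omega> \<in> below l n. t < S (Suc n) \<omega>} = {\<omega> \<in> below l n. t - S n \<omega> < \<xi> (Suc n) \<omega>}"
    by (auto simp: S_Suc)
  then show ?thesis
    using jump_prob[OF below_sets, where T = "\<lambda>\<omega>. t - S n \<omega>"] by simp
qed

text \<open>By \<open>jump_from_below\<close>, \<open>green z l n\<close> is the probability that the walk is alive and has stayed below \<open>l\<close> up to time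
  \<open>n\<close> and then jumps over \<open>z\<close>.\<close>

definition green :: "real \<Rightarrow> real \<Rightarrow> nat \<Rightarrow> real" where
  "green z l n = (\<integral>\<omega>. indicator (below l n) \<omega> * H (z - S n \<omega>) \<partial>M)"

lemma integrable_below_H: "integrable M (\<lambda>\<omega>. indicator (below l n) \<omega> * H (t - S n \<omega>))"
  by (rule integrable_const_bound[where B=1]) (auto simp: indicator_def step.H_nonneg step.H_le_1)

lemma green_nonneg: "0 \<le> green z l n"
  unfolding green_def by (intro integral_nonneg_AE) (auto simp: step.H_nonneg)

lemma green_mono_level:
  assumes "l \<le> l'"
  shows "green z l n \<le> green z l' n"
  unfolding green_def using assms
  by (intro integral_mono integrable_below_H) (force simp: indicator_def below_def step.H_nonneg)

lemma exceed_antimono: "x \<le> y \<Longrightarrow> prob (exceed y) \<le> prob (exceed x)"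
  by (intro finite_measure_mono) (auto simp: exceed_def intro: le_less_trans)

section \<open>Supermartingale estimates for the walk\<close>

text \<open>Ville's inequality for a nonnegative supermartingale that starts at
  \<open>G (w + z0)\<close> on \<open>B\<close>. Only the sign of the drift matters, and
  \<open>\<sigma>\<close> may be ignored, since letting the walk run on only enlarges the event. The
  bound does not involve the target level, so a large \<open>w\<close> makes it uniformly
  small.\<close>

lemma maximal_inequality:
  assumes dr: "\<And>z. z \<ge> z0 \<Longrightarrow> (\<integral>y. G (max R (z - y)) \<partial>N) \<le> G z - c * H z"
    and c: "0 \<le> c" and R: "R \<le> z0" and w: "0 \<le> w" and B: "B \<in> sets (Fl n)"
  shows "prob {\<omega> \<in> B. \<exists>k\<ge>n. w < S k \<omega> - S n \<omega>} * G z0 \<le> prob B * G (w + z0)"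
proof -
  define E where "E j = {\<omega> \<in> B. \<forall>i\<le>j. S (n + i) \<omega> - S n \<omega> \<le> w}" for j
  \<comment> \<open>\<open>G (max R (T j))\<close> is a supermartingale while the walk has not climbed by \<open>w\<close>, and at least \<open>G z0\<close> afterwards.\<close>
  define T where "T j \<omega> = w + z0 - (S (n + j) \<omega> - S n \<omega>)" for j \<omega>
  have Bs: "B \<subseteq> space M" using sets.sets_into_space[OF B] by simp
  have BM [measurable]: "B \<in> events" using B filt_sub by blast
  have E_Fl: "E j \<in> sets (Fl (n + j))" for j
  proof -
    have [measurable]: "B \<in> sets (Fl (n + j))" using B Fl_mono[of n "n + j"] by auto
    have [measurable]: "Measurable.pred (Fl (n + j)) (\<lambda>\<omega>. \<forall>i\<in>{..j}. S (n + i) \<omega> - S n \<omega> \<le> w)"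
    proof (rule pred_intros_finite)
      fix i assume "i \<in> {..j}"
      then have [measurable]: "S (n + i) \<in> borel_measurable (Fl (n + j))" "S n \<in> borel_measurable (Fl (n + j))"
        by (simp_all add: S_adapted)
      show "Measurable.pred (Fl (n + j)) (\<lambda>\<omega>. S (n + i) \<omega> - S n \<omega> \<le> w)" by measurable
    qed simp
    have "{\<omega> \<in> space (Fl (n + j)). \<omega> \<in> B \<and> (\<forall>i\<in>{..j}. S (n + i) \<omega> - S n \<omega> \<le> w)} \<in> sets (Fl (n + j))" by measurable
    also have "{\<omega> \<in> space (Fl (n + j)). \<omega> \<in> B \<and> (\<forall>i\<in>{..j}. S (n + i) \<omega> - S n \<omega> \<le> w)} = E j"
      using Bs by (auto simp: E_def)
    finally show ?thesis .
  qed
  have EM [measurable]: "E j \<in> events" for j using E_Fl[of j] filt_sub by blast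
  have T_Fl [measurable]: "T j \<in> borel_measurable (Fl (n + j))" for j
  proof -
    have [measurable]: "S (n + j) \<in> borel_measurable (Fl (n + j))" "S n \<in> borel_measurable (Fl (n + j))"
      by (simp_all add: S_adapted)
    show ?thesis unfolding T_def[abs_def] by measurable
  qed
  have [measurable]: "T j \<in> borel_measurable M" for j by (rule measurable_from_Fl[OF T_Fl])
  define u where "u j = (\<integral>\<omega>. indicator (E j) \<omega> * G (max R (T j \<omega>)) \<partial>M)" for j
  have int: "integrable M (\<lambda>\<omega>. indicator (E j) \<omega> * G (max R (T k \<omega>)))" for j k
    by (rule integrable_const_bound[where B="G R"]) (auto simp: indicator_def step.G_nonneg step.G_antimono)
  have Esub: "E (Suc j) \<subseteq> E j" for j by (auto simp: E_def)
  have indI: "integrable M (indicator (A) :: 'a \<Rightarrow> real)" if "A \<in> events" for A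
    using that by (simp add: integrable_indicator_iff emeasure_eq_measure)
  \<comment> \<open>Paths leaving \<open>E\<close> at this step have
    \<open>T (Suc j) \<omega> \<le> z0\<close>, hence value at least \<open>G z0\<close>. Setting
    this amount aside at every step makes the inequalities telescope.\<close>
  have step_le: "u (Suc j) + G z0 * prob (E j - E (Suc j)) \<le> u j" for j
  proof -
    have "u (Suc j) + G z0 * prob (E j - E (Suc j))
        = (\<integral>\<omega>. indicator (E (Suc j)) \<omega> * G (max R (T (Suc j) \<omega>)) + G z0 * indicator (E j - E (Suc j)) \<omega> \<partial>M)"
      unfolding u_def by (subst Bochner_Integration.integral_add) (auto intro!: int integrable_mult_right indI)
    also have "\<dots> \<le> (\<integral>\<omega>. indicator (E j) \<omega> * G (max R (T (Suc j) \<omega>)) \<partial>M)"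
    proof (rule integral_mono)
      fix \<omega>
      show "indicator (E (Suc j)) \<omega> * G (max R (T (Suc j) \<omega>)) + G z0 * indicator (E j - E (Suc j)) \<omega>
        \<le> indicator (E j) \<omega> * G (max R (T (Suc j) \<omega>))"
      proof (cases "\<omega> \<in> E j - E (Suc j)")
        case True
        then have "T (Suc j) \<omega> \<le> z0" by (auto simp: E_def T_def not_le le_Suc_eq)
        then have "G z0 \<le> G (max R (T (Suc j) \<omega>))" using R by (intro step.G_antimono) auto
        then show ?thesis using True by simp
      next
        case False
        then show ?thesis using Esub[of j] by (auto simp: indicator_def)
      qed
    qed (auto intro!: int integrable_mult_right indI Bochner_Integration.integrable_add)
    also have "(\<lambda>\<omega>. indicator (E j) \<omega> * G (max R (T (Suc j) \<omega>)))
      = (\<lambda>\<omega>. indicator (E j) \<omega> * G (max R (T j \<omega> - \<xi> (Suc (n + j)) \<omega>)))"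
      by (auto simp: T_def S_Suc algebra_simps)
    also have "(\<integral>\<omega>. indicator (E j) \<omega> * G (max R (T j \<omega> - \<xi> (Suc (n + j)) \<omega>)) \<partial>M)
      \<le> u j - c * (\<integral>\<omega>. indicator (E j) \<omega> * H (T j \<omega>) \<partial>M)"
      unfolding u_def by (rule drift_step[OF dr E_Fl T_Fl _ R]) (auto simp: E_def T_def)
    also have "\<dots> \<le> u j"
      using c by (auto intro!: mult_nonneg_nonneg integral_nonneg_AE simp: step.H_nonneg)
    finally show ?thesis .
  qed
  have prob_E: "prob (E j - E (Suc j)) = prob (E j) - prob (E (Suc j))" for j
    using Esub[of j] by (intro finite_measure_Diff) auto
  have "u j + G z0 * (prob B - prob (E j)) \<le> u 0" for j
  proof (induction j)
    case 0
    have "E 0 = B" using w by (auto simp: E_def)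
    then show ?case by simp
  next
    case (Suc j)
    then show ?case using step_le[of j] by (simp add: prob_E algebra_simps)
  qed
  moreover have "u j \<ge> 0" for j
    unfolding u_def by (intro integral_nonneg_AE) (auto simp: step.G_nonneg)
  moreover have "u 0 \<le> prob B * G (w + z0)"
  proof -
    have "E 0 = B" using w by (auto simp: E_def)
    then show ?thesis using w R by (auto simp: u_def T_def max_def)
  qed
  ultimately have bound: "prob (B - E j) * G z0 \<le> prob B * G (w + z0)" for j
  proof -
    have "prob (B - E j) = prob B - prob (E j)" by (intro finite_measure_Diff) (auto simp: E_def)
    then show ?thesis
      using \<open>\<And>j. u j + G z0 * (prob B - prob (E j)) \<le> u 0\<close>[of j] \<open>\<And>j. u j \<ge> 0\<close>[of j] \<open>u 0 \<le> prob B * G (w + z0)\<close>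
      by (simp add: mult.commute)
  qed
  have "(\<lambda>j. prob (B - E j)) \<longlonglongrightarrow> prob (\<Union>j. B - E j)"
    by (rule finite_Lim_measure_incseq) (auto simp: incseq_def E_def)
  then have "(\<lambda>j. prob (B - E j) * G z0) \<longlonglongrightarrow> prob (\<Union>j. B - E j) * G z0"
    by (intro tendsto_mult tendsto_const)
  then have "prob (\<Union>j. B - E j) * G z0 \<le> prob B * G (w + z0)"
    by (rule LIMSEQ_le_const2) (use bound in auto)
  also have "(\<Union>j. B - E j) = {\<omega> \<in> B. \<exists>k\<ge>n. w < S k \<omega> - S n \<omega>}"
  proof (intro set_eqI iffI)
    fix \<omega> assume "\<omega> \<in> (\<Union>j. B - E j)"
    then obtain i where "\<omega> \<in> B" "w < S (n + i) \<omega> - S n \<omega>" by (auto simp: E_def not_le)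
    then show "\<omega> \<in> {\<omega> \<in> B. \<exists>k\<ge>n. w < S k \<omega> - S n \<omega>}" by (intro CollectI conjI exI[of _ "n + i"]) auto
  next
    fix \<omega> assume "\<omega> \<in> {\<omega> \<in> B. \<exists>k\<ge>n. w < S k \<omega> - S n \<omega>}"
    then obtain k where k: "\<omega> \<in> B" "n \<le> k" "w < S k \<omega> - S n \<omega>" by blast
    then have "\<omega> \<notin> E (k - n)" by (auto simp: E_def not_le intro!: exI[of _ "k - n"])
    with k show "\<omega> \<in> (\<Union>j. B - E j)" by blast
  qed
  finally show ?thesis .
qed

text \<open>Sums the one-step inequalities for \<open>\<Phi>\<close> along the walk killed on
  leaving \<open>below l\<close>; \<open>\<Phi>\<close> vanishes at the start and its final
  expectation is dropped as nonnegative. The mean \<open>- m\<close> of the step, met by the linear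
  term, yields the first summand on the right. The other two bound \<open>err\<close> at the exit:
  its constant part by \<open>exceed (z - R)\<close>, its linear part by \<open>Y\<close>, which
  dominates the exit position. Stopping at a finite \<open>K\<close> keeps all expectations
  finite.\<close>

lemma potential_bound:
  assumes dr: "\<And>z. z \<ge> z0 \<Longrightarrow> (\<integral>y. G (max R (z - y)) \<partial>N) \<le> G z - c * H z"
    and R: "R \<le> z0" and z: "R \<le> z" "0 \<le> z - z0"
    and Y: "integrable M Y" "\<And>\<omega>. 0 \<le> Y \<omega>"
    and YS: "AE \<omega> in M. \<forall>n. (\<Sum>k<n. indicator {\<omega>. enat k < \<sigma> \<omega>} \<omega> * max 0 (\<xi> (Suc k) \<omega>)) \<le> Y \<omega>"
  shows "c * (\<Sum>n<K. green z (z - z0) n)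
    \<le> m * H z * (\<Sum>n<K. prob {\<omega> \<in> space M. enat n < \<sigma> \<omega>}) + G z * prob (exceed (z - R))
      + H z * (\<integral>\<omega>. Y \<omega> * indicator {\<omega>. z - R < Y \<omega>} \<omega> \<partial>M)"
proof -
  define l where "l = z - z0"
  have lR: "l \<le> z - R" using R by (simp add: l_def)
  define \<Phi> where "\<Phi> y = G (max R (z - y)) - H z * y - G z" for y
  \<comment> \<open>makes \<open>\<Phi> + err\<close> nonnegative where truncation at \<open>R\<close> destroys the tangent inequality\<close>
  define err where "err y = (G z + H z * y) * indicator {z - R<..} y" for y
  have [measurable]: "\<Phi> \<in> borel_measurable borel" "err \<in> borel_measurable borel"
    unfolding \<Phi>_def[abs_def] err_def[abs_def] by measurable
  have \<Phi>_nonneg: "0 \<le> \<Phi> y" if "y \<le> z - R" for y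
    using step.G_above_tangent[of z y] that by (simp add: \<Phi>_def max_def)
  have err_zero: "err y = 0" if "y \<le> z - R" for y using that by (simp add: err_def)
  have \<Phi>_err: "0 \<le> \<Phi> y + err y" for y
  proof (cases "y \<le> z - R")
    case False
    then show ?thesis by (simp add: \<Phi>_def err_def step.G_nonneg)
  qed (simp add: \<Phi>_nonneg err_zero)
  have intS: "integrable M (\<lambda>\<omega>. indicator A \<omega> * S k \<omega>)" if "A \<in> events" for A k
    using integrable_real_mult_indicator[OF that integrable_S[of k]] by (simp add: mult.commute)
  have intG: "integrable M (\<lambda>\<omega>. indicator A \<omega> * G (max R (z - S k \<omega>)))" if [measurable]: "A \<in> events" for A k
    by (rule integrable_const_bound[where B="G R"]) (auto simp: indicator_def step.G_nonneg step.G_antimono)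
  have indI: "integrable M (indicator (A) :: 'a \<Rightarrow> real)" if "A \<in> events" for A
    using that by (simp add: integrable_indicator_iff emeasure_eq_measure)
  have \<Phi>_ind: "indicator A \<omega> * \<Phi> y = indicator A \<omega> * G (max R (z - y)) - H z * (indicator A \<omega> * y) - G z * indicator A \<omega>"
    for A and \<omega> :: 'a and y by (simp add: \<Phi>_def algebra_simps)
  have int\<Phi>: "integrable M (\<lambda>\<omega>. indicator A \<omega> * \<Phi> (S k \<omega>))" if "A \<in> events" for A k
    unfolding \<Phi>_ind using that
    by (intro Bochner_Integration.integrable_diff intG integrable_mult_right intS indI)
  have val\<Phi>: "(\<integral>\<omega>. indicator A \<omega> * \<Phi> (S k \<omega>) \<partial>M) = (\<integral>\<omega>. indicator A \<omega> * G (max R (z - S k \<omega>)) \<partial>M)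
      - H z * (\<integral>\<omega>. indicator A \<omega> * S k \<omega> \<partial>M) - G z * prob A" if "A \<in> events" for A k
    unfolding \<Phi>_ind using that
    by (simp add: intG intS indI Int_absorb2 sets.sets_into_space)
  have interr: "integrable M (\<lambda>\<omega>. indicator A \<omega> * err (S k \<omega>))" if [measurable]: "A \<in> events" for A k
  proof (rule Bochner_Integration.integrable_bound)
    show "integrable M (\<lambda>\<omega>. G z + H z * \<bar>S k \<omega>\<bar>)"
      by (intro Bochner_Integration.integrable_add integrable_mult_right integrable_abs integrable_S) simp
    have "\<bar>err y\<bar> \<le> G z + H z * \<bar>y\<bar>" for y
      using step.G_nonneg[of z] step.H_nonneg[of z] abs_triangle_ineq[of "G z" "H z * y"]
      by (auto simp: err_def abs_mult indicator_def)
    then show "AE \<omega> in M. norm (indicator A \<omega> * err (S k \<omega>)) \<le> norm (G z + H z * \<bar>S k \<omega>\<bar>)"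
      by (auto simp: indicator_def step.G_nonneg step.H_nonneg)
  qed simp
  define u where "u n = (\<integral>\<omega>. indicator (below l n) \<omega> * \<Phi> (S n \<omega>) \<partial>M)" for n
  define p where "p n = prob {\<omega> \<in> space M. enat n < \<sigma> \<omega>}" for n
  define r where "r n = (\<integral>\<omega>. indicator (below l n) \<omega> * err (S (Suc n) \<omega>) \<partial>M)" for n
  \<comment> \<open>Killed paths lose \<open>\<Phi>\<close>, which may be negative after a large
    overshoot. Adding \<open>err\<close> makes the lost amount nonnegative; for surviving paths
    \<open>err\<close> is 0, since \<open>l \<le> z - R\<close>.\<close>
  have step_le: "u (Suc n) + c * green z l n \<le> u n + m * H z * p n + r n" for n
  proof -
    have "u (Suc n) \<le> (\<integral>\<omega>. indicator (below l n) \<omega> * \<Phi> (S (Suc n) \<omega>) + indicator (below l n) \<omega> * err (S (Suc n) \<omega>) \<partial>M)"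
      unfolding u_def
    proof (intro integral_mono int\<Phi> Bochner_Integration.integrable_add interr below_events)
      fix \<omega>
      show "indicator (below l (Suc n)) \<omega> * \<Phi> (S (Suc n) \<omega>)
        \<le> indicator (below l n) \<omega> * \<Phi> (S (Suc n) \<omega>) + indicator (below l n) \<omega> * err (S (Suc n) \<omega>)"
      proof (cases "\<omega> \<in> below l (Suc n)")
        case True
        then have "S (Suc n) \<omega> \<le> z - R" using lR by (auto simp: below_def intro: order_trans)
        then show ?thesis using True below_Suc_subset[of l n] by (auto simp: err_zero)
      next
        case False
        then show ?thesis using \<Phi>_err[of "S (Suc n) \<omega>"] by (auto simp: indicator_def)
      qed
    qed
    also have "\<dots> = (\<integral>\<omega>. indicator (below l n) \<omega> * \<Phi> (S (Suc n) \<omega>) \<partial>M) + r n"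
      unfolding r_def by (intro Bochner_Integration.integral_add int\<Phi> interr below_events)
    also have "(\<integral>\<omega>. indicator (below l n) \<omega> * \<Phi> (S (Suc n) \<omega>) \<partial>M) \<le> u n - c * green z l n + m * H z * prob (below l n)"
    proof -
      have [measurable]: "S n \<in> borel_measurable (Fl n)" by (rule S_adapted) simp
      have "(\<integral>\<omega>. indicator (below l n) \<omega> * G (max R (z - S n \<omega> - \<xi> (Suc n) \<omega>)) \<partial>M)
        \<le> (\<integral>\<omega>. indicator (below l n) \<omega> * G (max R (z - S n \<omega>)) \<partial>M) - c * (\<integral>\<omega>. indicator (below l n) \<omega> * H (z - S n \<omega>) \<partial>M)"
        by (rule drift_step[OF dr below_sets _ _ R]) (auto simp: below_def l_def)
      then have 1: "(\<integral>\<omega>. indicator (below l n) \<omega> * G (max R (z - S (Suc n) \<omega>)) \<partial>M)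
        \<le> (\<integral>\<omega>. indicator (below l n) \<omega> * G (max R (z - S n \<omega>)) \<partial>M) - c * green z l n"
        by (simp add: S_Suc green_def diff_diff_eq)
      have "(\<integral>\<omega>. indicator (below l n) \<omega> * S (Suc n) \<omega> \<partial>M)
        = (\<integral>\<omega>. indicator (below l n) \<omega> * S n \<omega> + indicator (below l n) \<omega> * \<xi> (Suc n) \<omega> \<partial>M)"
        by (simp add: S_Suc distrib_left)
      also have "\<dots> = (\<integral>\<omega>. indicator (below l n) \<omega> * S n \<omega> \<partial>M) + - m * prob (below l n)"
        using past_times_step[OF below_sets step.integrable_id, of l n] by (simp add: intS step.mean_eq)
      finally have 2: "H z * (\<integral>\<omega>. indicator (below l n) \<omega> * S (Suc n) \<omega> \<partial>M)
          = H z * (\<integral>\<omega>. indicator (below l n) \<omega> * S n \<omega> \<partial>M) - m * H z * prob (below l n)"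
        by (simp only: distrib_left) simp
      show ?thesis unfolding u_def val\<Phi>[OF below_events] using 1 2 by linarith
    qed
    also have "m * H z * prob (below l n) \<le> m * H z * p n"
      unfolding p_def using step.m_pos step.H_nonneg[of z]
      by (intro mult_left_mono finite_measure_mono) (auto simp: below_def)
    finally show ?thesis by simp
  qed
  have tel: "u n + c * (\<Sum>k<n. green z l k) \<le> u 0 + m * H z * (\<Sum>k<n. p k) + (\<Sum>k<n. r k)" for n
  proof (induction n)
    case (Suc n)
    then show ?case using step_le[of n] by (simp add: algebra_simps)
  qed simp
  have u0: "u 0 = 0" using z by (simp add: u_def \<Phi>_def)
  have uK: "0 \<le> u K"
    unfolding u_def
  proof (intro integral_nonneg_AE AE_I2)
    fix \<omega>
    show "0 \<le> indicator (below l K) \<omega> * \<Phi> (S K \<omega>)"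
    proof (cases "\<omega> \<in> below l K")
      case True
      then have "S K \<omega> \<le> z - R" using lR by (auto simp: below_def intro: order_trans)
      then show ?thesis by (simp add: \<Phi>_nonneg)
    qed simp
  qed
  have intYI: "integrable M (\<lambda>\<omega>. Y \<omega> * indicator {\<omega>. z - R < Y \<omega>} \<omega>)"
  proof (rule Bochner_Integration.integrable_bound[OF Y(1)])
    have [measurable]: "Y \<in> borel_measurable M" using Y(1) by (rule borel_measurable_integrable)
    have "(\<lambda>\<omega>. Y \<omega> * indicator {\<omega>. z - R < Y \<omega>} \<omega>) = (\<lambda>\<omega>. if z - R < Y \<omega> then Y \<omega> else 0)" by (auto simp: indicator_def)
    then show "(\<lambda>\<omega>. Y \<omega> * indicator {\<omega>. z - R < Y \<omega>} \<omega>) \<in> borel_measurable M" by simp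
  qed (auto simp: indicator_def)
  have "(\<Sum>n<K. r n) = (\<integral>\<omega>. (\<Sum>n<K. indicator (below l n) \<omega> * err (S (Suc n) \<omega>)) \<partial>M)"
    unfolding r_def by (rule Bochner_Integration.integral_sum[symmetric]) (intro interr below_events)
  also have "\<dots> \<le> (\<integral>\<omega>. G z * indicator (exceed (z - R)) \<omega> + H z * (Y \<omega> * indicator {\<omega>. z - R < Y \<omega>} \<omega>) \<partial>M)"
  proof (rule integral_mono_AE)
    show "AE \<omega> in M. (\<Sum>n<K. indicator (below l n) \<omega> * err (S (Suc n) \<omega>))
      \<le> G z * indicator (exceed (z - R)) \<omega> + H z * (Y \<omega> * indicator {\<omega>. z - R < Y \<omega>} \<omega>)"
      using YS
    proof eventually_elim
      case (elim \<omega>)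
      let ?rhs = "G z * indicator (exceed (z - R)) \<omega> + H z * (Y \<omega> * indicator {\<omega>. z - R < Y \<omega>} \<omega>)"
      let ?t = "\<lambda>n. indicator (below l n) \<omega> * err (S (Suc n) \<omega>)"
      have rhs_nonneg: "0 \<le> ?rhs"
        by (intro add_nonneg_nonneg mult_nonneg_nonneg) (auto simp: step.G_nonneg step.H_nonneg Y)
      show ?case
      proof (cases "\<exists>n. \<omega> \<in> below l n \<and> z - R < S (Suc n) \<omega>")
        case False
        then have "?t n = 0" for n by (cases "\<omega> \<in> below l n") (auto simp: err_zero not_less)
        then have "(\<Sum>n<K. ?t n) = 0" by (intro sum.neutral ballI)
        then show ?thesis using rhs_nonneg by (simp only:)
      next
        case True
        then obtain n where n: "\<omega> \<in> below l n" "z - R < S (Suc n) \<omega>" by blast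
        \<comment> \<open>A landing above \<open>z - R\<close> is also above \<open>l\<close>, so it
          ends membership in \<open>below l\<close> for good: the sum over time has at most one
          nonzero term.\<close>
        have other: "?t k = 0" if "k \<noteq> n" for k
        proof (cases "\<omega> \<in> below l k \<and> z - R < S (Suc k) \<omega>")
          case True
          have "Suc k \<le> n \<or> Suc n \<le> k" using that by auto
          then show ?thesis
          proof
            assume "Suc k \<le> n"
            then have "S (Suc k) \<omega> \<le> l" using n by (auto simp: below_def)
            then show ?thesis using True lR by auto
          next
            assume "Suc n \<le> k"
            then have "S (Suc n) \<omega> \<le> l" using True by (auto simp: below_def)
            then show ?thesis using n lR by auto
          qed
        next
          case False
          then show ?thesis by (cases "\<omega> \<in> below l k") (auto simp: err_zero not_less)
        qed
        \<comment> \<open>Every increment up to the exit is taken while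
          \<open>enat k < \<sigma> \<omega>\<close>, so the exit position is at most a partial sum
          dominated by \<open>Y\<close>.\<close>
        have "S (Suc n) \<omega> = (\<Sum>k<Suc n. \<xi> (Suc k) \<omega>)"
          unfolding rw_def by (rule sum.reindex_bij_witness[of _ Suc "\<lambda>i. i - 1"]) auto
        also have "\<dots> \<le> (\<Sum>k<Suc n. indicator {\<omega>. enat k < \<sigma> \<omega>} \<omega> * max 0 (\<xi> (Suc k) \<omega>))"
        proof (rule sum_mono)
          fix k assume "k \<in> {..<Suc n}"
          then have "enat k \<le> enat n" by simp
          also have "enat n < \<sigma> \<omega>" using n by (simp add: below_def)
          finally show "\<xi> (Suc k) \<omega> \<le> indicator {\<omega>. enat k < \<sigma> \<omega>} \<omega> * max 0 (\<xi> (Suc k) \<omega>)" by simp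
        qed
        also have "\<dots> \<le> Y \<omega>" using elim by blast
        finally have SY: "S (Suc n) \<omega> \<le> Y \<omega>" .
        have ex: "\<omega> \<in> exceed (z - R)"
          using n by (auto simp: below_def exceed_def Suc_ile_eq[symmetric])
        have tn: "?t n \<le> ?rhs"
          using n SY ex mult_left_mono[OF SY step.H_nonneg[of z]] by (simp add: err_def)
        have "(\<Sum>k<K. ?t k) = (\<Sum>k<K. if k = n then ?t n else 0)"
          by (intro sum.cong refl) (auto simp: other)
        also have "\<dots> \<le> ?rhs" using tn rhs_nonneg by simp
        finally show ?thesis .
      qed
    qed
  qed (intro Bochner_Integration.integrable_sum interr below_events Bochner_Integration.integrable_add
      integrable_mult_right indI intYI exceed_events)+
  also have "\<dots> = G z * prob (exceed (z - R)) + H z * (\<integral>\<omega>. Y \<omega> * indicator {\<omega>. z - R < Y \<omega>} \<omega> \<partial>M)"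
    by (subst Bochner_Integration.integral_add) (auto intro!: integrable_mult_right indI intYI)
  finally have "(\<Sum>n<K. r n) \<le> \<dots>" .
  then show ?thesis using tel[of K] u0 uK unfolding l_def p_def by linarith
qed

section \<open>Lower bound by a single big jump\<close>

abbreviation alive_prob :: "nat \<Rightarrow> real" where
  "alive_prob n \<equiv> prob {\<omega> \<in> space M. enat n < \<sigma> \<omega>}"

text \<open>From a position of at least \<open>- K\<close>, a jump above \<open>x + K\<close> lands
  above \<open>x \<ge> K\<close>. This breaks the bound \<open>K\<close> demanded by all later
  events, so the events are disjoint; the jump is independent of the past, which gives the
  product.\<close>

lemma exceed_prob_lower_bound:
  assumes "0 \<le> K" "K \<le> x"
  shows "(\<Sum>n<k. prob {\<omega> \<in> space M. enat n < \<sigma> \<omega> \<and> (\<forall>i\<in>{..n}. \<bar>S i \<omega>\<bar> \<le> K)}) * H (x + K) \<le> prob (exceed x)"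
proof -
  define B where "B n = {\<omega> \<in> space M. enat n < \<sigma> \<omega> \<and> (\<forall>i\<in>{..n}. \<bar>S i \<omega>\<bar> \<le> K)}" for n
  define D where "D n = {\<omega> \<in> B n. x + K < \<xi> (Suc n) \<omega>}" for n
  have B_Fl: "B n \<in> sets (Fl n)" for n
  proof -
    have [measurable]: "Measurable.pred (Fl n) (\<lambda>\<omega>. enat n < \<sigma> \<omega>)"
      by (rule alive_adapted) simp
    have [measurable]: "Measurable.pred (Fl n) (\<lambda>\<omega>. \<forall>i\<in>{..n}. \<bar>S i \<omega>\<bar> \<le> K)"
    proof (rule pred_intros_finite)
      fix i assume "i \<in> {..n}"
      then have [measurable]: "S i \<in> borel_measurable (Fl n)" by (simp add: S_adapted)
      show "Measurable.pred (Fl n) (\<lambda>\<omega>. \<bar>S i \<omega>\<bar> \<le> K)" by measurable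
    qed simp
    have "{\<omega> \<in> space (Fl n). enat n < \<sigma> \<omega> \<and> (\<forall>i\<in>{..n}. \<bar>S i \<omega>\<bar> \<le> K)} \<in> sets (Fl n)" by measurable
    then show ?thesis by (simp only: B_def space_Fl)
  qed
  have [measurable]: "B n \<in> events" for n using B_Fl[of n] filt_sub by blast
  have D_eq: "D n = {\<omega> \<in> space M. \<omega> \<in> B n \<and> x + K < \<xi> (Suc n) \<omega>}" for n
    by (auto simp: D_def B_def)
  have D_ev: "D n \<in> events" for n unfolding D_eq by measurable
  have prob_D: "prob (D n) = prob (B n) * H (x + K)" for n
    using jump_prob[OF B_Fl, of "\<lambda>_. x + K" n] by (simp add: D_def Int_absorb2 sets.sets_into_space)
  have big: "x < S (Suc n) \<omega>" if "\<omega> \<in> D n" for n \<omega>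
  proof -
    have "\<bar>S n \<omega>\<bar> \<le> K" "x + K < \<xi> (Suc n) \<omega>" using that by (auto simp: D_def B_def)
    then show ?thesis unfolding S_Suc by linarith
  qed
  have disj: "disjoint_family_on D {..<k}"
    unfolding disjoint_family_on_def
  proof (intro ballI impI)
    have *: "D i \<inter> D j = {}" if "Suc i \<le> j" for i j
    proof -
      have "S (Suc i) \<omega> \<le> K" if "\<omega> \<in> D j" for \<omega>
      proof -
        have "\<bar>S (Suc i) \<omega>\<bar> \<le> K" using that \<open>Suc i \<le> j\<close> unfolding D_def B_def by blast
        then show ?thesis by linarith
      qed
      then show ?thesis using big[of _ i] assms by force
    qed
    fix i j :: nat assume "i \<noteq> j"
    then have "Suc i \<le> j \<or> Suc j \<le> i" by auto
    then show "D i \<inter> D j = {}" using *[of i j] *[of j i] by blast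
  qed
  have "(\<Sum>n<k. prob (B n)) * H (x + K) = (\<Sum>n<k. prob (D n))"
    by (simp add: prob_D sum_distrib_right)
  also have "\<dots> = prob (\<Union>n\<in>{..<k}. D n)"
    by (rule finite_measure_finite_Union[symmetric]) (use D_ev disj in auto)
  also have "\<dots> \<le> prob (exceed x)"
  proof (rule finite_measure_mono)
    show "(\<Union>n\<in>{..<k}. D n) \<subseteq> exceed x"
    proof
      fix \<omega> assume "\<omega> \<in> (\<Union>n\<in>{..<k}. D n)"
      then obtain n where n: "\<omega> \<in> D n" by blast
      then have "enat (Suc n) \<le> \<sigma> \<omega>" "\<omega> \<in> space M" by (auto simp: D_def B_def Suc_ile_eq)
      then show "\<omega> \<in> exceed x" using big[OF n] by (auto simp: exceed_def)
    qed
  qed simp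
  finally show ?thesis by (simp only: B_def)
qed

text \<open>With \<open>k\<close> fixed, a large \<open>K\<close> recovers the first
  \<open>k\<close> alive probabilities up to an arbitrarily small loss, and long-tailedness then
  removes the shift by \<open>K\<close>. Comparing with a finite partial sum serves finite and
  infinite means of \<open>\<sigma>\<close> alike.\<close>

lemma eventually_exceed_gt:
  assumes "a < (\<Sum>n<k. alive_prob n)"
  shows "eventually (\<lambda>x. a < prob (exceed x) / H x) at_top"
proof -
  define q where "q K n = prob {\<omega> \<in> space M. enat n < \<sigma> \<omega> \<and> (\<forall>i\<in>{..n}. \<bar>S i \<omega>\<bar> \<le> K)}" for K n
  have "(\<lambda>j. q (real j) n) \<longlonglongrightarrow> alive_prob n" for n
  proof -
    let ?A = "\<lambda>j::nat. {\<omega> \<in> space M. enat n < \<sigma> \<omega> \<and> (\<forall>i\<in>{..n}. \<bar>S i \<omega>\<bar> \<le> real j)}"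
    have "(\<lambda>j. prob (?A j)) \<longlonglongrightarrow> prob (\<Union>j. ?A j)"
    proof (rule finite_Lim_measure_incseq)
      have "?A j \<in> events" for j by measurable
      then show "range ?A \<subseteq> events" by blast
      show "incseq ?A" by (force simp: incseq_def)
    qed
    also have "(\<Union>j. ?A j) = {\<omega> \<in> space M. enat n < \<sigma> \<omega>}"
    proof (intro set_eqI iffI)
      fix \<omega> assume w: "\<omega> \<in> {\<omega> \<in> space M. enat n < \<sigma> \<omega>}"
      obtain j :: nat where j: "(\<Sum>i\<le>n. \<bar>S i \<omega>\<bar>) \<le> real j" using real_arch_simple by blast
      have "\<bar>S i \<omega>\<bar> \<le> real j" if "i \<in> {..n}" for i
        using member_le_sum[OF that, of "\<lambda>i. \<bar>S i \<omega>\<bar>"] j by simp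
      then show "\<omega> \<in> (\<Union>j. ?A j)" using w by blast
    qed blast
    finally show ?thesis by (simp only: q_def)
  qed
  then have "(\<lambda>j. \<Sum>n<k. q (real j) n) \<longlonglongrightarrow> (\<Sum>n<k. alive_prob n)"
    by (intro tendsto_sum)
  from order_tendstoD(1)[OF this assms] obtain j :: nat where j: "a < (\<Sum>n<k. q (real j) n)"
    by (auto simp: eventually_sequentially)
  let ?s = "\<Sum>n<k. q (real j) n"
  have "((\<lambda>x. ?s * (H (x + real j) / H x)) \<longlongrightarrow> ?s * 1) at_top"
    by (intro tendsto_mult tendsto_const step.H_shift_any)
  then have "eventually (\<lambda>x. a < ?s * (H (x + real j) / H x)) at_top"
    using order_tendstoD(1) j by fastforce
  then show ?thesis using eventually_ge_at_top[of "real j"]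
  proof eventually_elim
    case (elim x)
    have "?s * H (x + real j) \<le> prob (exceed x)"
      unfolding q_def by (rule exceed_prob_lower_bound) (use elim in auto)
    then have "?s * (H (x + real j) / H x) \<le> prob (exceed x) / H x"
      using step.H_pos[of x] by (simp add: divide_right_mono)
    then show ?case using elim by linarith
  qed
qed

section \<open>Upper bound for a stopping time of finite mean\<close>

text \<open>Wald's identity for positive parts: whether step \<open>Suc n\<close> is taken is
  independent of that step, so the full series has expectation \<open>G 0\<close> times the sum of
  the alive probabilities. The series itself serves as \<open>Y\<close>.\<close>

lemma pos_part_sum_dominated:
  assumes "summable alive_prob"
  obtains Y where "integrable M Y" "\<And>\<omega>. 0 \<le> Y \<omega>"
    "AE \<omega> in M. \<forall>n. (\<Sum>k<n. indicator {\<omega>. enat k < \<sigma> \<omega>} \<omega> * max 0 (\<xi> (Suc k) \<omega>)) \<le> Y \<omega>"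
proof -
  define A where "A n = {\<omega> \<in> space M. enat n < \<sigma> \<omega>}" for n
  define f where "f n \<omega> = indicator (A n) \<omega> * max 0 (\<xi> (Suc n) \<omega>)" for n \<omega>
  have A_Fl: "A n \<in> sets (Fl n)" for n
  proof -
    have "Measurable.pred (Fl n) (\<lambda>\<omega>. enat n < \<sigma> \<omega>)" by (rule alive_adapted) simp
    then have "{\<omega> \<in> space (Fl n). enat n < \<sigma> \<omega>} \<in> sets (Fl n)" by measurable
    then show ?thesis by (simp only: A_def space_Fl)
  qed
  have [measurable]: "A n \<in> events" for n using A_Fl[of n] filt_sub by blast
  have fm [measurable]: "f n \<in> borel_measurable M" for n unfolding f_def[abs_def] by measurable
  have f_nonneg: "0 \<le> f n \<omega>" for n \<omega> by (simp add: f_def)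
  have G0: "integrable N (\<lambda>y. max 0 y)" "(\<integral>y. max 0 y \<partial>N) = G 0"
    using step.integrable_pos_part[of 0] by (simp_all add: step.G_def)
  have f_int: "(\<integral>\<^sup>+\<omega>. ennreal (f n \<omega>) \<partial>M) = ennreal (alive_prob n * G 0)" for n
  proof -
    have "(\<integral>\<^sup>+\<omega>. ennreal (f n \<omega>) \<partial>M) = ennreal (\<integral>\<omega>. f n \<omega> \<partial>M)"
      unfolding f_def by (rule nn_integral_eq_integral) (use past_times_step(2)[OF A_Fl G0(1)] in auto)
    also have "(\<integral>\<omega>. f n \<omega> \<partial>M) = alive_prob n * G 0"
      unfolding f_def past_times_step(1)[OF A_Fl G0(1)] G0(2) by (simp only: A_def)
    finally show ?thesis .
  qed
  define Y' where "Y' \<omega> = (\<Sum>n. ennreal (f n \<omega>))" for \<omega>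
  have [measurable]: "Y' \<in> borel_measurable M" unfolding Y'_def[abs_def] by measurable
  have "(\<integral>\<^sup>+\<omega>. Y' \<omega> \<partial>M) = (\<Sum>n. \<integral>\<^sup>+\<omega>. ennreal (f n \<omega>) \<partial>M)"
    unfolding Y'_def by (rule nn_integral_suminf) simp
  also have "\<dots> = ennreal (\<Sum>n. alive_prob n * G 0)"
    unfolding f_int by (rule suminf_ennreal2) (use assms step.G_nonneg[of 0] in \<open>auto intro: summable_mult2\<close>)
  finally have fin: "(\<integral>\<^sup>+\<omega>. Y' \<omega> \<partial>M) < \<infinity>" by simp
  have AE_fin: "AE \<omega> in M. Y' \<omega> \<noteq> \<infinity>"
    by (rule nn_integral_PInf_AE) (use fin in auto)
  \<comment> \<open>\<open>enn2real\<close> turns the value infinity into 0, so the domination holds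
    only almost everywhere.\<close>
  define Y where "Y \<omega> = enn2real (Y' \<omega>)" for \<omega>
  have [measurable]: "Y \<in> borel_measurable M" unfolding Y_def[abs_def] by measurable
  have Y_nonneg: "0 \<le> Y \<omega>" for \<omega> by (simp add: Y_def)
  have AE_Y: "AE \<omega> in M. ennreal (Y \<omega>) = Y' \<omega>"
    using AE_fin by eventually_elim (simp add: Y_def less_top[symmetric])
  have "integrable M Y"
  proof (rule integrableI_nonneg)
    have "(\<integral>\<^sup>+\<omega>. ennreal (Y \<omega>) \<partial>M) = (\<integral>\<^sup>+\<omega>. Y' \<omega> \<partial>M)" by (rule nn_integral_cong_AE[OF AE_Y])
    then show "(\<integral>\<^sup>+\<omega>. ennreal (Y \<omega>) \<partial>M) < \<infinity>" using fin by simp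
  qed (auto simp: Y_nonneg)
  moreover have "AE \<omega> in M. \<forall>n. (\<Sum>k<n. indicator {\<omega>. enat k < \<sigma> \<omega>} \<omega> * max 0 (\<xi> (Suc k) \<omega>)) \<le> Y \<omega>"
    using AE_Y AE_space
  proof eventually_elim
    case (elim \<omega>)
    show ?case
    proof
      fix n
      have "ennreal (\<Sum>k<n. f k \<omega>) = (\<Sum>k<n. ennreal (f k \<omega>))" by (rule sum_ennreal[symmetric]) (simp add: f_nonneg)
      also have "\<dots> \<le> Y' \<omega>" unfolding Y'_def by (rule sum_le_suminf) auto
      also note elim(1)[symmetric]
      finally have "(\<Sum>k<n. f k \<omega>) \<le> Y \<omega>" unfolding ennreal_le_iff[OF Y_nonneg] .
      moreover have "f k \<omega> = indicator {\<omega>. enat k < \<sigma> \<omega>} \<omega> * max 0 (\<xi> (Suc k) \<omega>)" for k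
        using elim(2) by (auto simp: f_def A_def indicator_def)
      ultimately show "(\<Sum>k<n. indicator {\<omega>. enat k < \<sigma> \<omega>} \<omega> * max 0 (\<xi> (Suc k) \<omega>)) \<le> Y \<omega>" by simp
    qed
  qed
  ultimately show ?thesis using Y_nonneg that by blast
qed

lemma upper_tail_expectation_tendsto_0:
  fixes Y :: "'a \<Rightarrow> real"
  assumes Y: "integrable M Y"
  shows "((\<lambda>t. \<integral>\<omega>. Y \<omega> * indicator {\<omega>. t < Y \<omega>} \<omega> \<partial>M) \<longlongrightarrow> 0) at_top"
proof -
  have [measurable]: "Y \<in> borel_measurable M" using Y by (rule borel_measurable_integrable)
  have ind: "Y \<omega> * indicator {\<omega>. t < Y \<omega>} \<omega> = (if t < Y \<omega> then Y \<omega> else 0)" for t \<omega> by (simp add: indicator_def)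
  have "((\<lambda>t. \<integral>\<omega>. Y \<omega> * indicator {\<omega>. t < Y \<omega>} \<omega> \<partial>M) \<longlongrightarrow> (\<integral>\<omega>. 0 \<partial>M)) at_top"
  proof (rule integral_dominated_convergence_at_top[where w="\<lambda>\<omega>. \<bar>Y \<omega>\<bar>"])
    show "AE \<omega> in M. ((\<lambda>t. Y \<omega> * indicator {\<omega>. t < Y \<omega>} \<omega>) \<longlongrightarrow> 0) at_top"
    proof (rule AE_I2)
      fix \<omega>
      have "eventually (\<lambda>t. 0 = Y \<omega> * indicator {\<omega>. t < Y \<omega>} \<omega>) at_top"
        using eventually_ge_at_top[of "Y \<omega>"] by eventually_elim simp
      then show "((\<lambda>t. Y \<omega> * indicator {\<omega>. t < Y \<omega>} \<omega>) \<longlongrightarrow> 0) at_top"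
        by (rule Lim_transform_eventually[OF tendsto_const])
    qed
    show "(\<lambda>\<omega>. Y \<omega> * indicator {\<omega>. t < Y \<omega>} \<omega>) \<in> borel_measurable M" for t
      unfolding ind by measurable
  qed (use Y in \<open>auto simp: indicator_def\<close>)
  then show ?thesis by simp
qed

text \<open>Long-tailedness gives the factor 2 only for large \<open>u\<close>. For smaller
  \<open>u\<close>, \<open>H u\<close> is at least \<open>H U > 0\<close> while the left side is at
  most 1. Uniformity in \<open>u\<close> is needed because \<open>z - S n \<omega>\<close> ranges
  over all of \<open>[z0, \<infinity>)\<close>.\<close>

lemma H_shift_bounded:
  obtains C where "1 \<le> C" "\<And>u. z0 \<le> u \<Longrightarrow> H (u - z0) \<le> C * H u"
proof -
  have "eventually (\<lambda>u. H (u + - z0) / H u < 2) at_top"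
    using order_tendstoD(2)[OF step.H_shift_any[of "- z0"], of 2] by simp
  then obtain U where U: "\<And>u. U \<le> u \<Longrightarrow> H (u - z0) / H u < 2"
    by (auto simp: eventually_at_top_linorder)
  define C where "C = max 2 (1 / H U)"
  have "H (u - z0) \<le> C * H u" for u
  proof (cases "U \<le> u")
    case True
    then have "H (u - z0) \<le> 2 * H u" using U[OF True] step.H_pos[of u] by (simp add: field_simps)
    also have "\<dots> \<le> C * H u" by (intro mult_right_mono) (auto simp: C_def step.H_nonneg)
    finally show ?thesis .
  next
    case False
    have "H (u - z0) \<le> 1" by (rule step.H_le_1)
    also have "\<dots> \<le> 1 / H U * H u"
      using step.H_antimono[of u U] False step.H_pos[of U] by (simp add: field_simps)
    also have "\<dots> \<le> C * H u" by (intro mult_right_mono) (auto simp: C_def step.H_nonneg)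
    finally show ?thesis .
  qed
  then show ?thesis using that[of C] by (auto simp: C_def)
qed

text \<open>Compares a jump over \<open>z - z0\<close> with a jump over \<open>z\<close>. The
  constant \<open>C\<close> is too large for the limit, but the order of magnitude suffices to
  absorb error terms.\<close>

lemma crude_bound:
  assumes C: "\<And>u. z0 \<le> u \<Longrightarrow> H (u - z0) \<le> C * H u" and z: "z0 \<le> z"
    and sm: "summable (green z (z - z0))"
  shows "prob (exceed (z - z0)) \<le> C * (\<Sum>n. green z (z - z0) n)"
proof -
  let ?l = "z - z0"
  have le: "prob {\<omega> \<in> below ?l n. ?l < S (Suc n) \<omega>} \<le> C * green z ?l n" for n
  proof -
    have "prob {\<omega> \<in> below ?l n. ?l < S (Suc n) \<omega>} = (\<integral>\<omega>. indicator (below ?l n) \<omega> * H (?l - S n \<omega>) \<partial>M)"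
      by (rule jump_from_below)
    also have "\<dots> \<le> (\<integral>\<omega>. C * (indicator (below ?l n) \<omega> * H (z - S n \<omega>)) \<partial>M)"
    proof (intro integral_mono integrable_mult_right integrable_below_H)
      fix \<omega>
      show "indicator (below ?l n) \<omega> * H (?l - S n \<omega>) \<le> C * (indicator (below ?l n) \<omega> * H (z - S n \<omega>))"
        using C[of "z - S n \<omega>"] by (auto simp: indicator_def below_def algebra_simps)
    qed
    also have "\<dots> = C * green z ?l n" by (simp add: green_def)
    finally show ?thesis .
  qed
  have sums: "(\<lambda>n. prob {\<omega> \<in> below ?l n. ?l < S (Suc n) \<omega>}) sums prob (exceed ?l)"
    by (rule passage_sums) (use z in simp)
  have "prob (exceed ?l) \<le> (\<Sum>n. C * green z ?l n)"
    unfolding sums_unique[OF sums]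
    by (intro suminf_le le summable_mult sm sums_summable[OF sums])
  then show ?thesis using suminf_mult[OF sm, of C] by simp
qed

text \<open>Watching the walk only up to the lower level \<open>z - w\<close> keeps
  \<open>z - S n \<omega>\<close> at least \<open>w\<close>, where the shift by the fixed
  \<open>w'\<close> costs a factor \<open>D\<close> that can be taken near 1. What remains carries
  the factor from \<open>maximal_inequality\<close>.\<close>

lemma refined_bound:
  assumes dr: "\<And>z. z \<ge> z0 \<Longrightarrow> (\<integral>y. G (max R (z - y)) \<partial>N) \<le> G z - c * H z"
    and c: "0 \<le> c" and R: "R \<le> z0" and w': "0 \<le> w'" "w' \<le> w" and z: "w \<le> z"
    and D: "\<And>u. w \<le> u \<Longrightarrow> H (u - w') \<le> D * H u"
    and sm: "summable (green z (z - w))"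
  shows "prob (exceed z) \<le> D * (\<Sum>n. green z (z - w) n) + G (w' + z0) / G z0 * prob (exceed (z - w))"
proof -
  let ?l = "z - w"
  \<comment> \<open>\<open>E n\<close>: first passage over \<open>z - w\<close> at time \<open>Suc n\<close>; it either lands above \<open>z - w'\<close> (\<open>U n\<close>),
    or the walk must still climb by \<open>w'\<close> (\<open>V n\<close>).\<close>
  define E where "E n = {\<omega> \<in> below ?l n. ?l < S (Suc n) \<omega>}" for n
  define U where "U n = {\<omega> \<in> below ?l n. z - w' < S (Suc n) \<omega>}" for n
  define V where "V n = {\<omega> \<in> E n. \<exists>k\<ge>Suc n. w' < S k \<omega> - S (Suc n) \<omega>}" for n
  define \<rho> where "\<rho> = G (w' + z0) / G z0"
  have E_Fl: "E n \<in> sets (Fl (Suc n))" for n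
  proof -
    have [measurable]: "below ?l n \<in> sets (Fl (Suc n))" by (rule subsetD[OF Fl_mono below_sets]) simp
    have [measurable]: "S (Suc n) \<in> borel_measurable (Fl (Suc n))" by (rule S_adapted) simp
    have "{\<omega> \<in> space (Fl (Suc n)). \<omega> \<in> below ?l n \<and> ?l < S (Suc n) \<omega>} \<in> sets (Fl (Suc n))" by measurable
    also have "{\<omega> \<in> space (Fl (Suc n)). \<omega> \<in> below ?l n \<and> ?l < S (Suc n) \<omega>} = E n"
      by (auto simp: E_def below_def)
    finally show ?thesis .
  qed
  have [measurable]: "E n \<in> events" for n using E_Fl[of n] filt_sub by blast
  have U_eq: "U n = {\<omega> \<in> space M. \<omega> \<in> below ?l n \<and> z - w' < S (Suc n) \<omega>}" for n
    by (auto simp: U_def below_def)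
  have V_eq: "V n = {\<omega> \<in> space M. \<omega> \<in> E n \<and> (\<exists>k\<ge>Suc n. w' < S k \<omega> - S (Suc n) \<omega>)}" for n
    by (auto simp: V_def E_def below_def)
  have [measurable]: "U n \<in> events" "V n \<in> events" for n unfolding U_eq V_eq by measurable
  have U_le: "prob (U n) \<le> D * green z ?l n" for n
  proof -
    have "prob (U n) = (\<integral>\<omega>. indicator (below ?l n) \<omega> * H (z - w' - S n \<omega>) \<partial>M)"
      unfolding U_def by (rule jump_from_below)
    also have "\<dots> \<le> (\<integral>\<omega>. D * (indicator (below ?l n) \<omega> * H (z - S n \<omega>)) \<partial>M)"
    proof (intro integral_mono integrable_mult_right integrable_below_H)
      fix \<omega>
      show "indicator (below ?l n) \<omega> * H (z - w' - S n \<omega>) \<le> D * (indicator (below ?l n) \<omega> * H (z - S n \<omega>))"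
        using D[of "z - S n \<omega>"] by (auto simp: indicator_def below_def algebra_simps)
    qed
    also have "\<dots> = D * green z ?l n" by (simp add: green_def)
    finally show ?thesis .
  qed
  have V_le: "prob (V n) \<le> \<rho> * prob (E n)" for n
    using maximal_inequality[OF dr c R w'(1) E_Fl, of n] step.G_pos[of z0]
    by (simp add: V_def \<rho>_def field_simps)
  have l0: "0 \<le> ?l" using z by simp
  have E_sums: "(\<lambda>n. prob (E n)) sums prob (exceed ?l)"
    unfolding E_def by (rule passage_sums[OF l0])
  have bound_sm: "summable (\<lambda>n. D * green z ?l n + \<rho> * prob (E n))"
    by (intro summable_add summable_mult sm sums_summable[OF E_sums])
  have UV_le: "prob (U n \<union> V n) \<le> D * green z ?l n + \<rho> * prob (E n)" for n
    using measure_Un_le[of "U n" M "V n"] U_le[of n] V_le[of n] by simp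
  have UV_sm: "summable (\<lambda>n. prob (U n \<union> V n))"
    by (rule summable_comparison_test'[OF bound_sm, of 0]) (use UV_le in auto)
  have "exceed z \<subseteq> (\<Union>n. U n \<union> V n)"
  proof
    fix \<omega> assume ex: "\<omega> \<in> exceed z"
    then obtain k where k: "z < S k \<omega>" by (auto simp: exceed_def)
    have "\<omega> \<in> exceed ?l" using ex w' by (force simp: exceed_def)
    then have "\<omega> \<in> (\<Union>n. E n)" using exceed_eq_UN[OF l0] by (simp only: E_def)
    then obtain n where n: "\<omega> \<in> E n" by blast
    have "\<not> k \<le> n"
    proof
      assume "k \<le> n"
      then have "S k \<omega> \<le> ?l" using n by (auto simp: E_def below_def)
      then show False using k w' by linarith
    qed
    then have "Suc n \<le> k" by simp
    have "\<omega> \<in> U n \<or> \<omega> \<in> V n"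
    proof (cases "z - w' < S (Suc n) \<omega>")
      case True
      then show ?thesis using n by (simp add: U_def E_def)
    next
      case False
      then have "w' < S k \<omega> - S (Suc n) \<omega>" using k by linarith
      then show ?thesis using n \<open>Suc n \<le> k\<close> unfolding V_def by blast
    qed
    then show "\<omega> \<in> (\<Union>n. U n \<union> V n)" by blast
  qed
  then have "prob (exceed z) \<le> prob (\<Union>n. U n \<union> V n)" by (intro finite_measure_mono) auto
  also have "\<dots> \<le> (\<Sum>n. prob (U n \<union> V n))"
    by (rule finite_measure_subadditive_countably) (use UV_sm in auto)
  also have "\<dots> \<le> (\<Sum>n. D * green z ?l n + \<rho> * prob (E n))"
    by (intro suminf_le UV_le UV_sm bound_sm)
  also have "\<dots> = D * (\<Sum>n. green z ?l n) + \<rho> * prob (exceed ?l)"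
    using sums_add[OF sums_mult[OF summable_sums[OF sm], of D] sums_mult[OF E_sums, of \<rho>]]
    by (rule sums_unique[symmetric])
  finally show ?thesis by (simp add: \<rho>_def)
qed

text \<open>With \<open>A z\<close> the sum of \<open>green\<close> at level \<open>z - z0\<close>,
  \<open>potential_bound\<close> controls \<open>(m - d) * A z\<close>. Its middle term is at most
  \<open>G z * C * A z\<close>, which is at most \<open>d * A z\<close> for large \<open>z\<close>;
  moving it to the left gives the denominator \<open>m - 2 * d\<close>. The \<open>d\<close> in the
  numerator bounds the tail expectation of \<open>Y\<close>, the factor \<open>1 + d\<close> comes
  from the long tail, and the last \<open>d\<close> pays for climbing \<open>w'\<close>.\<close>

lemma eventually_exceed_le:
  assumes sm: "summable alive_prob" and d: "0 < d" "2 * d < m"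
  shows "eventually (\<lambda>z. prob (exceed z) / H z
    \<le> (1 + d) * ((m * (\<Sum>n. alive_prob n) + d) / (m - 2 * d)) + d) at_top"
proof -
  define s where "s = (\<Sum>n. alive_prob n)"
  define L where "L = (m * s + d) / (m - 2 * d)"
  have s0: "0 \<le> s" unfolding s_def by (intro suminf_nonneg sm) simp
  have L0: "0 < L" using s0 d step.m_pos by (auto simp: L_def intro!: divide_pos_pos add_nonneg_pos)
  obtain R z0 where R: "0 \<le> R" "R \<le> z0"
    and dr: "\<And>z. z \<ge> z0 \<Longrightarrow> (\<integral>y. G (max R (z - y)) \<partial>N) \<le> G z - (m - d) * H z"
    using step.drift[OF d(1)] by blast
  have c: "0 \<le> m - d" using d by simp
  obtain C where C: "1 \<le> C" "\<And>u. z0 \<le> u \<Longrightarrow> H (u - z0) \<le> C * H u"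
    using H_shift_bounded by blast
  obtain Y where Y: "integrable M Y" "\<And>\<omega>. 0 \<le> Y \<omega>"
    "AE \<omega> in M. \<forall>n. (\<Sum>k<n. indicator {\<omega>. enat k < \<sigma> \<omega>} \<omega> * max 0 (\<xi> (Suc k) \<omega>)) \<le> Y \<omega>"
    using pos_part_sum_dominated[OF sm] by blast
  define r where "r t = (\<integral>\<omega>. Y \<omega> * indicator {\<omega>. t < Y \<omega>} \<omega> \<partial>M)" for t
  define A where "A z = (\<Sum>n. green z (z - z0) n)" for z
  have partial: "(m - d) * (\<Sum>n<k. green z (z - z0) n)
      \<le> m * H z * s + G z * prob (exceed (z - R)) + H z * r (z - R)" if z: "z0 \<le> z" for z k
  proof -
    have "m * H z * (\<Sum>n<k. alive_prob n) \<le> m * H z * s"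
      unfolding s_def using step.m_pos step.H_nonneg[of z]
      by (intro mult_left_mono sum_le_suminf sm) auto
    then show ?thesis
      using potential_bound[OF dr R(2) _ _ Y, of z k] R z unfolding r_def by simp
  qed
  \<comment> \<open>\<open>A z\<close> must be known to be finite before part of the bound, itself a
    multiple of \<open>A z\<close>, can be moved across.\<close>
  have summ: "summable (green z (z - z0))" if z: "z0 \<le> z" for z
  proof (rule bounded_imp_summable)
    fix k
    let ?b = "m * H z * s + G z * prob (exceed (z - R)) + H z * r (z - R)"
    have "(\<Sum>n<Suc k. green z (z - z0) n) \<le> ?b / (m - d)"
      using partial[OF z, of "Suc k"] d by (simp add: field_simps)
    then show "(\<Sum>n\<le>k. green z (z - z0) n) \<le> ?b / (m - d)" by (simp only: lessThan_Suc_atMost)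
  qed (rule green_nonneg)
  have A0: "0 \<le> A z" if "z0 \<le> z" for z
    unfolding A_def by (intro suminf_nonneg summ that green_nonneg)
  have crude: "prob (exceed (z - z0)) \<le> C * A z" if "z0 \<le> z" for z
    unfolding A_def by (rule crude_bound[OF C(2) that summ[OF that]])
  have A_le: "(m - d) * A z \<le> m * H z * s + G z * (C * A z) + H z * r (z - R)" if z: "z0 \<le> z" for z
  proof -
    have "(m - d) * A z = (\<Sum>n. (m - d) * green z (z - z0) n)"
      unfolding A_def by (rule suminf_mult[symmetric, OF summ[OF z]])
    also have "\<dots> \<le> m * H z * s + G z * prob (exceed (z - R)) + H z * r (z - R)"
      using partial[OF z] by (intro suminf_le_const summable_mult summ[OF z]) (simp add: sum_distrib_left)
    also have "prob (exceed (z - R)) \<le> C * A z"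
      using exceed_antimono[of "z - z0" "z - R"] crude[OF z] R by simp
    finally show ?thesis using step.G_nonneg[of z] by (simp add: mult_left_mono)
  qed
  have ev_r: "eventually (\<lambda>z. r (z - R) < d) at_top"
  proof -
    have "filterlim (\<lambda>x. x - R) at_top (at_top :: real filter)"
      using filterlim_tendsto_add_at_top[OF tendsto_const[of "- R"] filterlim_ident] by (simp add: algebra_simps)
    from filterlim_compose[OF upper_tail_expectation_tendsto_0[OF Y(1)] this]
    show ?thesis unfolding r_def[symmetric] using order_tendstoD(2) d by blast
  qed
  have ev_G: "eventually (\<lambda>z. G z < d / C) at_top"
    using order_tendstoD(2)[OF step.G_tendsto_0, of "d / C"] d C by simp
  have ev_A: "eventually (\<lambda>z. A z \<le> L * H z) at_top"
    using ev_r ev_G eventually_ge_at_top[of z0]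
  proof eventually_elim
    case (elim z)
    have "G z * C \<le> d" using elim(2) C by (simp add: field_simps)
    then have "G z * C * A z \<le> d * A z" using A0[OF elim(3)] by (rule mult_right_mono)
    moreover have "H z * r (z - R) \<le> H z * d" using elim(1) step.H_nonneg[of z] by (intro mult_left_mono) auto
    ultimately have "(m - 2 * d) * A z \<le> (m * s + d) * H z"
      using A_le[OF elim(3)] by (simp add: algebra_simps)
    then show ?case using d by (simp add: L_def field_simps)
  qed
  \<comment> \<open>Chosen to cancel the estimate \<open>2 * C * L * H z\<close> for passing
    \<open>z - w\<close> obtained below, leaving \<open>d * H z\<close>.\<close>
  define e where "e = d / (2 * C * L)"
  have e: "0 < e" using d C L0 by (simp add: e_def)
  have "eventually (\<lambda>t. G t < e * G z0) at_top"
    using order_tendstoD(2)[OF step.G_tendsto_0, of "e * G z0"] e step.G_pos[of z0] by simp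
  then obtain t where t: "\<And>u. t \<le> u \<Longrightarrow> G u < e * G z0" by (auto simp: eventually_at_top_linorder)
  define w' where "w' = max 0 (t - z0)"
  have w'0: "0 \<le> w'" and "t \<le> w' + z0" by (auto simp: w'_def)
  then have \<rho>: "G (w' + z0) / G z0 \<le> e"
    using t[of "w' + z0"] step.G_pos[of z0] by (simp add: field_simps)
  have "eventually (\<lambda>u. H (u + - w') / H u < 1 + d) at_top"
    using order_tendstoD(2)[OF step.H_shift_any[of "- w'"], of "1 + d"] d by simp
  then obtain w1 where w1: "\<And>u. w1 \<le> u \<Longrightarrow> H (u - w') / H u < 1 + d" by (auto simp: eventually_at_top_linorder)
  \<comment> \<open>\<open>w1\<close> is where the shift by \<open>w'\<close> costs less than
    \<open>1 + d\<close>; \<open>z0\<close> makes the level \<open>z - w\<close> at most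
    \<open>z - z0\<close>, so \<open>A z\<close> bounds the smaller sum; \<open>w'\<close> is
    required by \<open>refined_bound\<close>.\<close>
  define w where "w = max w1 (max z0 w')"
  have w: "w1 \<le> w" "z0 \<le> w" "w' \<le> w" by (auto simp: w_def)
  have D: "H (u - w') \<le> (1 + d) * H u" if "w \<le> u" for u
    using w1[of u] w(1) that step.H_pos[of u] by (simp add: field_simps)
  have lim: "filterlim (\<lambda>x. x + (z0 - w)) at_top (at_top :: real filter)"
    using filterlim_tendsto_add_at_top[OF tendsto_const[of "z0 - w"] filterlim_ident] by (simp add: algebra_simps)
  have ev_A': "eventually (\<lambda>z. A (z + (z0 - w)) \<le> L * H (z + (z0 - w))) at_top"
    using filterlim_iff[THEN iffD1, OF lim] ev_A by blast
  have ev_H: "eventually (\<lambda>z. H (z + (z0 - w)) / H z < 2) at_top"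
    using order_tendstoD(2)[OF step.H_shift_any, of 2] by simp
  have "eventually (\<lambda>z. prob (exceed z) / H z \<le> (1 + d) * L + d) at_top"
    using ev_A ev_A' ev_H eventually_ge_at_top[of w]
  proof eventually_elim
    case (elim z)
    have z0z: "z0 \<le> z" using elim(4) w by simp
    have gl: "green z (z - w) n \<le> green z (z - z0) n" for n using w by (intro green_mono_level) simp
    have gs: "summable (green z (z - w))"
      by (rule summable_comparison_test'[OF summ[OF z0z], of 0]) (use gl green_nonneg in auto)
    have gA: "(\<Sum>n. green z (z - w) n) \<le> A z"
      unfolding A_def by (intro suminf_le gl gs summ z0z)
    \<comment> \<open>The crude bound at the shifted point \<open>z + (z0 - w)\<close>, whose
      watched level is exactly \<open>z - w\<close>.\<close>
    have "prob (exceed (z - w)) \<le> C * A (z + (z0 - w))"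
      using crude[of "z + (z0 - w)"] elim(4) by (simp add: algebra_simps)
    also have "\<dots> \<le> C * (L * H (z + (z0 - w)))" using elim(2) C by (intro mult_left_mono) auto
    also have "\<dots> \<le> C * (L * (2 * H z))"
      using elim(3) C L0 step.H_pos[of z] by (intro mult_left_mono) (auto simp: field_simps)
    finally have Qw: "prob (exceed (z - w)) \<le> 2 * C * L * H z" by (simp add: algebra_simps)
    have "prob (exceed z) \<le> (1 + d) * (\<Sum>n. green z (z - w) n) + G (w' + z0) / G z0 * prob (exceed (z - w))"
      by (rule refined_bound[OF dr c R(2) w'0 w(3) elim(4) D gs])
    also have "\<dots> \<le> (1 + d) * (L * H z) + e * (2 * C * L * H z)"
    proof (intro add_mono mult_mono \<rho> Qw)
      show "(\<Sum>n. green z (z - w) n) \<le> L * H z" using gA elim(1) by linarith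
      show "0 \<le> (\<Sum>n. green z (z - w) n)" by (intro suminf_nonneg gs green_nonneg)
    qed (use d e in auto)
    also have "e * (2 * C * L * H z) = d * H z" using C L0 by (simp add: e_def)
    finally have "prob (exceed z) \<le> ((1 + d) * L + d) * H z" by (simp add: algebra_simps)
    then show ?case using step.H_pos[of z] by (simp add: field_simps)
  qed
  then show ?thesis by (simp only: L_def s_def)
qed

section \<open>The limit, with finite or infinite mean\<close>

text \<open>The upper bound holds for every small \<open>d > 0\<close>, and as \<open>d\<close>
  decreases to 0 its right-hand side tends to \<open>m * s / m = s\<close>, with \<open>s\<close>
  the sum of the alive probabilities.\<close>

lemma exceed_ratio_tendsto:
  assumes sm: "summable alive_prob"
  shows "((\<lambda>z. prob (exceed z) / H z) \<longlongrightarrow> (\<Sum>n. alive_prob n)) at_top"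
proof (rule order_tendstoI)
  fix a assume "a < (\<Sum>n. alive_prob n)"
  with order_tendstoD(1)[OF summable_LIMSEQ[OF sm]] obtain k where "a < (\<Sum>n<k. alive_prob n)"
    by (auto simp: eventually_sequentially)
  then show "eventually (\<lambda>z. a < prob (exceed z) / H z) at_top" by (rule eventually_exceed_gt)
next
  fix b assume b: "(\<Sum>n. alive_prob n) < b"
  let ?s = "\<Sum>n. alive_prob n"
  have "((\<lambda>d. (1 + d) * ((m * ?s + d) / (m - 2 * d)) + d) \<longlongrightarrow> (1 + 0) * ((m * ?s + 0) / (m - 2 * 0)) + 0) (at_right 0)"
    using step.m_pos by (intro tendsto_intros) auto
  then have "((\<lambda>d. (1 + d) * ((m * ?s + d) / (m - 2 * d)) + d) \<longlongrightarrow> ?s) (at_right 0)"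
    using step.m_pos by simp
  from order_tendstoD(2)[OF this b]
  have "eventually (\<lambda>d. (1 + d) * ((m * ?s + d) / (m - 2 * d)) + d < b) (at_right 0)" .
  moreover have "eventually (\<lambda>d::real. 0 < d) (at_right 0)" by (rule eventually_at_right_less)
  moreover have "eventually (\<lambda>d::real. d < m / 2) (at_right 0)"
    by (rule eventually_at_right_real[of 0 "m / 2", THEN eventually_mono]) (use step.m_pos in auto)
  ultimately have "eventually (\<lambda>d. (1 + d) * ((m * ?s + d) / (m - 2 * d)) + d < b \<and> 0 < d \<and> d < m / 2) (at_right 0)"
    by (intro eventually_conj)
  then obtain d where d: "(1 + d) * ((m * ?s + d) / (m - 2 * d)) + d < b" "0 < d" "d < m / 2"
    using eventually_happens'[of "at_right (0::real)"] by (auto simp: trivial_limit_at_right_real)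
  show "eventually (\<lambda>z. prob (exceed z) / H z < b) at_top"
    using eventually_exceed_le[OF sm d(2)] d by (auto elim: eventually_mono)
qed

lemma nn_integral_stopping_time:
  "(\<integral>\<^sup>+\<omega>. ennreal_of_enat (\<sigma> \<omega>) \<partial>M) = (\<Sum>n. ennreal (alive_prob n))"
proof -
  have pt: "ennreal_of_enat k = (\<Sum>n. indicator {n. enat n < k} n)" for k :: enat
  proof (cases k)
    case (enat j)
    have "(\<Sum>n. indicator {n. enat n < k} n :: ennreal) = (\<Sum>n<j. indicator {n. enat n < k} n)"
      by (rule suminf_finite) (auto simp: enat)
    also have "\<dots> = (\<Sum>n<j. 1)" by (intro sum.cong) (auto simp: enat)
    finally show ?thesis by (simp add: enat)
  next
    case infinity
    have "(\<Sum>n. 1 :: ennreal) = top"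
    proof (rule ccontr)
      assume "(\<Sum>n. 1 :: ennreal) \<noteq> top"
      then obtain j :: nat where "(\<Sum>n. 1 :: ennreal) < of_nat j"
        using ennreal_Ex_less_of_nat less_top by blast
      moreover have "of_nat j \<le> (\<Sum>n. 1 :: ennreal)"
        using sum_le_suminf[of "\<lambda>_. 1 :: ennreal" "{..<j}"] by simp
      ultimately show False by simp
    qed
    then show ?thesis by (simp add: infinity)
  qed
  have "(\<integral>\<^sup>+\<omega>. ennreal_of_enat (\<sigma> \<omega>) \<partial>M) = (\<integral>\<^sup>+\<omega>. (\<Sum>n. indicator {\<omega> \<in> space M. enat n < \<sigma> \<omega>} \<omega>) \<partial>M)"
    unfolding pt by (intro nn_integral_cong suminf_cong) (auto simp: indicator_def)
  also have "\<dots> = (\<Sum>n. \<integral>\<^sup>+\<omega>. indicator {\<omega> \<in> space M. enat n < \<sigma> \<omega>} \<omega> \<partial>M)"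
    by (rule nn_integral_suminf) measurable
  also have "\<dots> = (\<Sum>n. ennreal (alive_prob n))"
    by (intro suminf_cong) (subst nn_integral_indicator, measurable, simp add: emeasure_eq_measure)
  finally show ?thesis .
qed

text \<open>If the alive probabilities are not summable, their partial sums pass every bound, and
  \<open>eventually_exceed_gt\<close> alone forces the limit \<open>top\<close>.\<close>

lemma exceed_ratio_tendsto_ennreal:
  "((\<lambda>z. ennreal (prob (exceed z) / H z)) \<longlongrightarrow> (\<integral>\<^sup>+\<omega>. ennreal_of_enat (\<sigma> \<omega>) \<partial>M)) at_top"
proof (cases "summable alive_prob")
  case True
  have "(\<Sum>n. ennreal (alive_prob n)) = ennreal (\<Sum>n. alive_prob n)"
    by (rule suminf_ennreal2) (use True in auto)
  then show ?thesis
    unfolding nn_integral_stopping_time using tendsto_ennrealI[OF exceed_ratio_tendsto[OF True]] by simp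
next
  case False
  have top: "(\<Sum>n. ennreal (alive_prob n)) = top"
    using False summable_suminf_not_top[where f=alive_prob] measure_nonneg by blast
  show ?thesis
    unfolding nn_integral_stopping_time top
  proof (rule order_tendstoI)
    fix a :: ennreal assume "a < top"
    then obtain b where b: "a = ennreal b" "0 \<le> b" by (cases a) auto
    have "\<exists>k. b < (\<Sum>n<k. alive_prob n)"
    proof (rule ccontr)
      assume "\<not> ?thesis"
      then have "(\<Sum>n<k. alive_prob n) \<le> b" for k by (meson not_less)
      from this[of "Suc _"] have "(\<Sum>n\<le>k. alive_prob n) \<le> b" for k
        unfolding lessThan_Suc_atMost .
      then have "summable alive_prob" by (intro bounded_imp_summable[of _ b]) auto
      then show False using False by simp
    qed
    then obtain k where "b < (\<Sum>n<k. alive_prob n)" by blast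
    from eventually_exceed_gt[OF this] show "eventually (\<lambda>z. a < ennreal (prob (exceed z) / H z)) at_top"
      by eventually_elim (use b in \<open>simp add: ennreal_less_iff\<close>)
  qed simp
qed

end

section \<open>Transfer to the original hypotheses\<close>

theorem theorem1:
  fixes M :: "'a measure" and \<xi> :: "nat \<Rightarrow> 'a \<Rightarrow> real" and F :: "real \<Rightarrow> real"
    and Fl :: "nat \<Rightarrow> 'a measure" and \<sigma> :: "'a \<Rightarrow> enat" and m :: real
  assumes P: "prob_space M"
    and rv: "\<And>n. n \<ge> 1 \<Longrightarrow> \<xi> n \<in> borel_measurable M"
    and indep: "prob_space.indep_vars M (\<lambda>_. borel) \<xi> {1..}"
    and ident: "\<And>n. n \<ge> 1 \<Longrightarrow> distr M borel (\<xi> n) = distr M borel (\<xi> 1)"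
    and F_def: "\<And>x. F x = measure M {\<omega> \<in> space M. \<xi> 1 \<omega> \<le> x}"
    and mean: "integrable M (\<xi> 1)" "m > 0" "(\<integral>\<omega>. \<xi> 1 \<omega> \<partial>M) = - m"
    and tail_pos: "\<And>x. tailF F x > 0"
    and long_tailed: "\<And>c. c > 0 \<Longrightarrow> ((\<lambda>x. tailF F (x - c) / tailF F x) \<longlongrightarrow> 1) at_top"
    and Sstar: "S_star F"
    and filt: "filtration (space M) Fl"
    and filt_sub: "\<And>n. sets (Fl n) \<subseteq> sets M"
    and adapted: "\<And>n. n \<ge> 1 \<Longrightarrow> \<xi> n \<in> borel_measurable (Fl n)"
    and indep_future: "\<And>n. prob_space.indep_set M (sets (Fl n))
                          {\<xi> (Suc n) -` A \<inter> space M | A. A \<in> sets borel}"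
    and stopping: "\<And>n::nat. Measurable.pred (Fl n) (\<lambda>\<omega>. \<sigma> \<omega> \<le> enat n)"
  shows "((\<lambda>x. ennreal (measure M {\<omega> \<in> space M. ereal x < max_upto \<xi> \<sigma> \<omega>} / tailF F x))
           \<longlongrightarrow> (\<integral>\<^sup>+ \<omega>. ennreal_of_enat (\<sigma> \<omega>) \<partial>M)) at_top"
proof -
  interpret prob_space M by (rule P)
  let ?N = "distr M borel (\<xi> (Suc 0))"
  have X [measurable]: "\<xi> (Suc 0) \<in> borel_measurable M" using rv[of "Suc 0"] by simp
  have N: "real_distribution ?N" by (rule real_distribution_distr) simp
  interpret law: negative_mean_distribution ?N m
  proof (intro negative_mean_distribution.intro N negative_mean_distribution_axioms.intro)
    show "integrable ?N (\<lambda>y. y)" using mean(1) by (simp add: integrable_distr_eq)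
    show "(\<integral>y. y \<partial>?N) = - m" using mean(3) by (simp add: integral_distr)
  qed (rule mean(2))
  \<comment> \<open>Identifies the tail of the step law with that of \<open>F\<close>, so that the
    hypotheses on \<open>F\<close> become those of the locale.\<close>
  have HF: "law.H = tailF F"
  proof
    fix x
    have "law.H x = prob {\<omega> \<in> space M. x < \<xi> (Suc 0) \<omega>}"
      unfolding law.H_def by (subst measure_distr) (auto intro!: arg_cong[where f=prob])
    also have "{\<omega> \<in> space M. x < \<xi> (Suc 0) \<omega>} = space M - {\<omega> \<in> space M. \<xi> (Suc 0) \<omega> \<le> x}" by auto
    also have "prob \<dots> = 1 - prob {\<omega> \<in> space M. \<xi> (Suc 0) \<omega> \<le> x}" by (rule prob_compl) measurable
    finally show "law.H x = tailF F x" by (simp add: tailF_def F_def)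
  qed
  interpret law: strong_subexponential_distribution ?N m
  proof
    show "0 < law.H x" for x by (simp add: HF tail_pos)
    show "((\<lambda>x. law.H (x - c) / law.H x) \<longlongrightarrow> 1) at_top" if "0 < c" for c
      using long_tailed[OF that] by (simp add: HF)
    have "mean_plus F = law.G 0"
      unfolding mean_plus_def using law.set_integral_H by (simp add: HF)
    then show "(\<lambda>z. LBINT s:{0..z}. law.H (z - s) * law.H s) \<sim>[at_top] (\<lambda>z. 2 * law.G 0 * law.H z)"
      using Sstar unfolding S_star_def HF by simp
  qed
  interpret stopped_walk M \<xi> m Fl \<sigma>
  proof (intro stopped_walk.intro stopped_walk_axioms.intro)
    show "distr M borel (\<xi> (Suc n)) = ?N" for n using ident[of "Suc n"] by simp
    show "\<xi> (Suc n) \<in> borel_measurable (Fl (Suc n))" for n by (rule adapted) simp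
  qed (fact P law.strong_subexponential_distribution_axioms filt filt_sub indep_future stopping)+
  \<comment> \<open>A supremum is strictly above \<open>x\<close> iff some member is, so it need not
    be attained and the case of infinite \<open>\<sigma>\<close> is included.\<close>
  have "{\<omega> \<in> space M. ereal x < max_upto \<xi> \<sigma> \<omega>} = exceed x" for x
    by (auto simp: exceed_def max_upto_def less_SUP_iff)
  then show ?thesis
    using exceed_ratio_tendsto_ennreal by (simp add: HF)
qed

end
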